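(* Let $E=E(\mathbf{n},\mathbf{c})$ be a uniform Cantor set with associated data $\Lambda$, $\{m_k\}_{k\in\Lambda}$. Let $\mathbb{P}=\{P_k\}_{k=1}^\infty$ be an $\mathbf{n}$-matching sequence of positive probability vectors $P_k=(p_{k,1},\dots,p_{k,n_k})$, and let $\mu_{\mathbb{P}}$ be the measure on $E$ determined by $\mathbb{P}$. If $\sup_{k\ge1}n_k<\infty$, then $\mu_{\mathbb{P}}$ is doubling on $E$ if and only if there is a constant $C>1$ such that (a) $C^{-1}p_{k,i}\le p_{k,i+1}\le Cp_{k,i}$ for all $1\le i<n_k$ and all $k\ge1$, and (b) for all $k\in\Lambda$ and all $1\le t<m_k$, $$C^{-1}\prod_{j=1}^{t}p_{k+j,1}\leq\prod_{j=1}^{t}p_{k+j,n_{k+j}}\leq C\prod_{j=1}^{t}p_{k+j,1}.$$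
   Context: Uniform Cantor set: let $\mathbf{n}=\{n_k\}_{k\ge1}$ be integers with $n_k\geq 2$ and $\mathbf{c}=\{c_k\}_{k\ge1}$ real numbers in $(0,1)$ with $(n_k-1)c_k<1$ for all $k$. Put $E_0=[0,1]$; $E_k$ is obtained from $E_{k-1}$ by deleting from every component $I$ of $E_{k-1}$ exactly $n_k-1$ open intervals, each of length $c_k|I|$, such that the remaining $n_k$ closed intervals are of equal length. Then $E(\mathbf{n},\mathbf{c})=\bigcap_{k\ge 0}E_k$, with the metric inherited from $\mathbb{R}$. Components of $E_k$ are called components of level $k$, and components of $E_{k-1}\setminus E_k$ gaps of level $k$. The length of a component of level $k$ is $\delta_k=\prod_{i=1}^k\frac{1-(n_i-1)c_i}{n_i}$ (with $\delta_0=1$) and the length of a gap of level $k$ is $\varepsilon_k=c_k\delta_{k-1}$. Words: $W_k=\{i_1\cdots i_k:1\le i_j\le n_j\}$, $W_0=\{\text{empty word}\}$, and $I_{\text{empty}}=[0,1]$. Inductively, for $w\in W_{k-1}$, $I_{w1},\dots,I_{wn_k}$ denote from left to right the $n_k$ components of level $k$ contained in $I_w$. Data: $\Lambda=\{k\ge1:\varepsilon_k<\delta_k\}$. For $k\in\Lambda$, $m_k$ is the unique positive integer with $\delta_{k+m_k}\le\varepsilon_k<\delta_{k+m_k-1}$. A vector is a positive probability vector if its entries are all positive and sum to $1$. A sequence $\mathbb{P}=\{P_k\}_{k\ge1}$ of positive probability vectors is $\mathbf{n}$-matching if $P_k=(p_{k,1},\dots,p_{k,n_k})$ has $n_k$ entries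 for each $k$. Then $\mu_{\mathbb{P}}$ is the unique Borel probability measure on $E(\mathbf{n},\mathbf{c})$ with $\mu_{\mathbb{P}}(I_{wi})=p_{k,i}\,\mu_{\mathbb{P}}(I_w)$ for all $k\ge1$, $w\in W_{k-1}$, $1\le i\le n_k$ (where $\mu_{\mathbb{P}}(I)$ means $\mu_{\mathbb{P}}(I\cap E)$). A Borel regular measure $\mu$ on a metric space $X$ is doubling if there is a constant $C\ge1$ with $0<\mu(B(x,2r))\le C\mu(B(x,r))<\infty$ for all $x\in X$ and $r>0$. *)

theory Defs
  imports "HOL-Analysis.Analysis" "HOL-Probability.Probability"
begin

section \<open>Uniform Cantor sets\<close>

text \<open>All sequences are indexed from 1; their values at index 0 are never used.\<close>

definition uniform_cantor_data :: "(nat \<Rightarrow> nat) \<Rightarrow> (nat \<Rightarrow> real) \<Rightarrow> bool" where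
  "uniform_cantor_data n c \<longleftrightarrow>
     (\<forall>k\<ge>1. 2 \<le> n k \<and> 0 < c k \<and> c k < 1 \<and> (real (n k) - 1) * c k < 1)"

definition len :: "real set \<Rightarrow> real" where
  "len I = Sup I - Inf I"

text \<open>
  Deleting from a compact interval \<open>I\<close> exactly \<open>N - 1\<close> open intervals of length \<open>c * len I\<close> so that
  \<open>N\<close> closed intervals of equal length remain forces each remaining interval to have length
  \<open>(1 - (N - 1) * c) / N * len I\<close>, and forces remaining intervals and deleted ones to alternate.
  Hence the \<open>i\<close>-th remaining interval from the left (\<open>1 \<le> i \<le> N\<close>) is \<open>child N c I i\<close>, and the
  \<open>i\<close>-th deleted one (\<open>1 \<le> i < N\<close>) is \<open>gap N c I i\<close>.
\<close>

definition rem_len :: "nat \<Rightarrow> real \<Rightarrow> real set \<Rightarrow> real" where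
  "rem_len N c I = (1 - (real N - 1) * c) / real N * len I"

definition child_left :: "nat \<Rightarrow> real \<Rightarrow> real set \<Rightarrow> nat \<Rightarrow> real" where
  "child_left N c I i = Inf I + (real i - 1) * (rem_len N c I + c * len I)"

definition child :: "nat \<Rightarrow> real \<Rightarrow> real set \<Rightarrow> nat \<Rightarrow> real set" where
  "child N c I i = {child_left N c I i .. child_left N c I i + rem_len N c I}"

definition gap :: "nat \<Rightarrow> real \<Rightarrow> real set \<Rightarrow> nat \<Rightarrow> real set" where
  "gap N c I i =
     {child_left N c I i + rem_len N c I <..< child_left N c I i + rem_len N c I + c * len I}"

primrec level :: "(nat \<Rightarrow> nat) \<Rightarrow> (nat \<Rightarrow> real) \<Rightarrow> nat \<Rightarrow> real set" where
  "level n c 0 = {0..1}"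
| "level n c (Suc k) =
     level n c k - (\<Union>I\<in>components (level n c k). \<Union>i\<in>{1..<n (Suc k)}. gap (n (Suc k)) (c (Suc k)) I i)"

definition cantor_set :: "(nat \<Rightarrow> nat) \<Rightarrow> (nat \<Rightarrow> real) \<Rightarrow> real set" where
  "cantor_set n c = (\<Inter>k. level n c k)"

definition words :: "(nat \<Rightarrow> nat) \<Rightarrow> nat \<Rightarrow> nat list set" where
  "words n k = {w. length w = k \<and> (\<forall>j<k. 1 \<le> w ! j \<and> w ! j \<le> n (Suc j))}"

text \<open>
  \<open>cyl n c w\<close> is the interval \<open>I\<^sub>w\<close>. The recursion is on the last letter of the word, whence the
  reversal; see \<open>cyl_snoc\<close>. That these intervals are the components of \<open>level n c k\<close>, numbered from
  left to right inside their parents, is proved in \<open>components_level\<close>, \<open>components_level_within\<close>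
  and \<open>cyl_left_to_right\<close>.
\<close>

primrec cyl_rev :: "(nat \<Rightarrow> nat) \<Rightarrow> (nat \<Rightarrow> real) \<Rightarrow> nat list \<Rightarrow> real set" where
  "cyl_rev n c [] = {0..1}"
| "cyl_rev n c (i # w) = child (n (Suc (length w))) (c (Suc (length w))) (cyl_rev n c w) i"

definition cyl :: "(nat \<Rightarrow> nat) \<Rightarrow> (nat \<Rightarrow> real) \<Rightarrow> nat list \<Rightarrow> real set" where
  "cyl n c w = cyl_rev n c (rev w)"

definition delta :: "(nat \<Rightarrow> nat) \<Rightarrow> (nat \<Rightarrow> real) \<Rightarrow> nat \<Rightarrow> real" where
  "delta n c k = (\<Prod>i=1..k. (1 - (real (n i) - 1) * c i) / real (n i))"

definition eps :: "(nat \<Rightarrow> nat) \<Rightarrow> (nat \<Rightarrow> real) \<Rightarrow> nat \<Rightarrow> real" where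
  "eps n c k = c k * delta n c (k - 1)"

definition Lambda :: "(nat \<Rightarrow> nat) \<Rightarrow> (nat \<Rightarrow> real) \<Rightarrow> nat set" where
  "Lambda n c = {k. 1 \<le> k \<and> eps n c k < delta n c k}"

text \<open>Only meaningful for \<open>k \<in> Lambda n c\<close>; see \<open>mm_ex1\<close>.\<close>

definition mm :: "(nat \<Rightarrow> nat) \<Rightarrow> (nat \<Rightarrow> real) \<Rightarrow> nat \<Rightarrow> nat" where
  "mm n c k =
     (THE m. 1 \<le> m \<and> delta n c (k + m) \<le> eps n c k \<and> eps n c k < delta n c (k + m - 1))"


section \<open>Measures\<close>

text \<open>The entries of the vector \<open>P k\<close> are \<open>P k 1, \<dots>, P k (n k)\<close>.\<close>

definition n_matching :: "(nat \<Rightarrow> nat) \<Rightarrow> (nat \<Rightarrow> nat \<Rightarrow> real) \<Rightarrow> bool" where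
  "n_matching n P \<longleftrightarrow>
     (\<forall>k\<ge>1. (\<forall>i\<in>{1..n k}. 0 < P k i) \<and> (\<Sum>i=1..n k. P k i) = 1)"

definition is_cantor_measure ::
  "(nat \<Rightarrow> nat) \<Rightarrow> (nat \<Rightarrow> real) \<Rightarrow> (nat \<Rightarrow> nat \<Rightarrow> real) \<Rightarrow> real measure \<Rightarrow> bool" where
  "is_cantor_measure n c P \<mu> \<longleftrightarrow>
     prob_space \<mu> \<and>
     sets \<mu> = sets (restrict_space borel (cantor_set n c)) \<and>
     (\<forall>k\<ge>1. \<forall>w\<in>words n (k - 1). \<forall>i\<in>{1..n k}.
        measure \<mu> (cyl n c (w @ [i]) \<inter> cantor_set n c)
          = P k i * measure \<mu> (cyl n c w \<inter> cantor_set n c))"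

text \<open>
  \<open>X\<close> carries the metric of the ambient type, so its balls are the sets \<open>X \<inter> ball x r\<close>. A Borel
  regular (outer) measure is determined by its restriction to the Borel sets, and every measure on
  the Borel sets arises as such a restriction; thus it is represented by a measure on the Borel
  sigma-algebra of \<open>X\<close>.
\<close>

definition doubling_measure_on :: "'a::metric_space set \<Rightarrow> 'a measure \<Rightarrow> bool" where
  "doubling_measure_on X \<mu> \<longleftrightarrow>
     sets \<mu> = sets (restrict_space borel X) \<and>
     (\<exists>C\<ge>1. \<forall>x\<in>X. \<forall>r>0.
        0 < emeasure \<mu> (X \<inter> ball x (2 * r)) \<and>
        emeasure \<mu> (X \<inter> ball x (2 * r)) \<le> ennreal C * emeasure \<mu> (X \<inter> ball x r) \<and>
        ennreal C * emeasure \<mu> (X \<inter> ball x r) < \<infinity>)"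


section \<open>Basic facts\<close>

lemma cyl_Nil [simp]: "cyl n c [] = {0..1}"
  by (simp add: cyl_def)

lemma cyl_snoc [simp]:
  "cyl n c (w @ [i]) = child (n (Suc (length w))) (c (Suc (length w))) (cyl n c w) i"
  by (simp add: cyl_def)

lemma words_0 [simp]: "words n 0 = {[]}"
  by (auto simp: words_def)

lemma words_Suc: "words n (Suc k) = (\<lambda>(w, i). w @ [i]) ` (words n k \<times> {1..n (Suc k)})"
proof (intro equalityI subsetI)
  fix v assume v: "v \<in> words n (Suc k)"
  then have "v \<noteq> []" by (auto simp: words_def)
  then obtain w i where vw: "v = w @ [i]" by (metis rev_exhaust)
  have len: "length w = k" using v vw by (simp add: words_def)
  have nth: "\<And>j. j < Suc k \<Longrightarrow> 1 \<le> v ! j \<and> v ! j \<le> n (Suc j)"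
    using v by (auto simp: words_def)
  have "w \<in> words n k"
    unfolding words_def using nth len vw by (auto simp: nth_append) (metis less_SucI)+
  moreover have "i \<in> {1..n (Suc k)}" using nth[of k] len vw by (auto simp: nth_append)
  ultimately show "v \<in> (\<lambda>(w, i). w @ [i]) ` (words n k \<times> {1..n (Suc k)})"
    using vw by force
next
  fix v assume "v \<in> (\<lambda>(w, i). w @ [i]) ` (words n k \<times> {1..n (Suc k)})"
  then show "v \<in> words n (Suc k)"
    by (auto simp: words_def nth_append less_Suc_eq)
qed

lemma length_words: "w \<in> words n k \<Longrightarrow> length w = k"
  by (simp add: words_def)

lemma finite_words: "finite (words n k)"
  by (induction k) (auto simp: words_Suc)

lemma delta_0 [simp]: "delta n c 0 = 1"
  by (simp add: delta_def)

lemma delta_Suc: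
  "delta n c (Suc k) = delta n c k * ((1 - (real (n (Suc k)) - 1) * c (Suc k)) / real (n (Suc k)))"
  by (simp add: delta_def)

context
  fixes N :: nat and c a b :: real
  assumes N: "2 \<le> N" and c0: "0 < c" and c1: "(real N - 1) * c < 1" and ab: "a < b"
begin

private lemma simps_ab: "Inf {a..b} = a" "len {a..b} = b - a"
  using ab by (auto simp: len_def)

private lemma rem_pos: "0 < rem_len N c {a..b}"
  using N c1 ab by (simp add: rem_len_def simps_ab)

private lemma gap_pos: "0 < c * len {a..b}"
  using c0 ab by (simp add: simps_ab)

private lemma child_left_mono: "i \<le> j \<Longrightarrow> child_left N c {a..b} i \<le> child_left N c {a..b} j"
  unfolding child_left_def using rem_pos gap_pos by (intro add_left_mono mult_right_mono) auto

private lemma child_left_Suc: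
  "child_left N c {a..b} (Suc i)
     = child_left N c {a..b} i + rem_len N c {a..b} + c * len {a..b}"
  by (simp add: child_left_def algebra_simps)

private lemma child_left_1: "child_left N c {a..b} (Suc 0) = a"
  using ab by (simp add: child_left_def simps_ab)

private lemma child_left_N: "child_left N c {a..b} N + rem_len N c {a..b} = b"
proof -
  have "child_left N c {a..b} N + rem_len N c {a..b}
      = a + real N * rem_len N c {a..b} + (real N - 1) * c * (b - a)"
    by (simp add: child_left_def simps_ab algebra_simps)
  also have "real N * rem_len N c {a..b} = (1 - (real N - 1) * c) * (b - a)"
    using N by (simp add: rem_len_def simps_ab)
  finally show ?thesis by (simp add: algebra_simps)
qed

private lemma child_order:
  assumes "i < j" "x \<in> child N c {a..b} i" "y \<in> child N c {a..b} j"
  shows "x < y"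
  using child_left_mono[of "Suc i" j] child_left_Suc[of i] gap_pos assms
  by (auto simp: child_def)

private lemma child_subset:
  assumes "i \<in> {1..N}" shows "child N c {a..b} i \<subseteq> {a..b}"
  using child_left_mono[of "Suc 0" i] child_left_mono[of i N] child_left_1 child_left_N assms
  by (auto simp: child_def)

private lemma gap_subset:
  assumes "i \<in> {1..<N}" shows "gap N c {a..b} i \<subseteq> {a..b}"
  using child_left_mono[of "Suc 0" i] child_left_mono[of "Suc i" N] child_left_Suc[of i]
    child_left_1 child_left_N assms rem_pos
  by (auto simp: gap_def)

private lemma diff_gaps:
  "{a..b} - (\<Union>i\<in>{1..<N}. gap N c {a..b} i) = (\<Union>i\<in>{1..N}. child N c {a..b} i)"
proof (intro equalityI subsetI)
  fix x assume x: "x \<in> {a..b} - (\<Union>i\<in>{1..<N}. gap N c {a..b} i)"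
  define S where "S = {i\<in>{1..N}. child_left N c {a..b} i \<le> x}"
  have "Suc 0 \<in> S" using x child_left_1 N by (auto simp: S_def)
  moreover have fin: "finite S" by (simp add: S_def)
  ultimately have mem: "Max S \<in> S" using Max_in by blast
  have "x \<le> child_left N c {a..b} (Max S) + rem_len N c {a..b}"
  proof (cases "Max S = N")
    case True
    then show ?thesis using child_left_N x by simp
  next
    case False
    then have lt: "Max S \<in> {1..<N}" using mem by (auto simp: S_def)
    have "Suc (Max S) \<notin> S" using fin by (metis Max_ge Suc_n_not_le_n)
    then have "x < child_left N c {a..b} (Suc (Max S))" using lt by (auto simp: S_def)
    moreover have "x \<notin> gap N c {a..b} (Max S)" using x lt by blast
    ultimately show ?thesis by (auto simp: gap_def child_left_Suc)
  qed
  then show "x \<in> (\<Union>i\<in>{1..N}. child N c {a..b} i)"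
    using mem by (auto simp: S_def child_def)
next
  fix x assume "x \<in> (\<Union>i\<in>{1..N}. child N c {a..b} i)"
  then obtain i where i: "i \<in> {1..N}" and x: "x \<in> child N c {a..b} i" by blast
  have "x \<notin> gap N c {a..b} j" for j
  proof (cases "i \<le> j")
    case True
    then show ?thesis using child_left_mono[of i j] x by (auto simp: child_def gap_def)
  next
    case False
    then show ?thesis using child_left_mono[of "Suc j" i] child_left_Suc[of j] x
      by (auto simp: child_def gap_def)
  qed
  then show "x \<in> {a..b} - (\<Union>i\<in>{1..<N}. gap N c {a..b} i)"
    using child_subset[OF i] x by blast
qed

lemmas subdivide = rem_pos child_order child_subset gap_subset diff_gaps

end

lemma cyl_interval:
  assumes "uniform_cantor_data n c" and "w \<in> words n k"
  shows "\<exists>a b. a < b \<and> cyl n c w = {a..b} \<and> b - a = delta n c k"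
  using assms(2)
proof (induction k arbitrary: w)
  case 0
  then show ?case by (auto intro!: exI[of _ 0] exI[of _ 1])
next
  case (Suc k)
  then obtain v i where v: "v \<in> words n k" and w: "w = v @ [i]"
    by (auto simp: words_Suc)
  obtain a b where ab: "a < b" "cyl n c v = {a..b}" "b - a = delta n c k"
    using Suc.IH[OF v] by blast
  let ?N = "n (Suc k)" and ?c = "c (Suc k)"
  have data: "2 \<le> ?N" "0 < ?c" "(real ?N - 1) * ?c < 1"
    using assms(1) by (auto simp: uniform_cantor_data_def)
  have r: "rem_len ?N ?c {a..b} = delta n c (Suc k)"
    using ab by (simp add: rem_len_def len_def delta_Suc)
  show ?case
    using subdivide(1)[OF data ab(1)] r ab(2) length_words[OF v]
    by (auto simp: w child_def)
qed

corollary len_cyl: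
  assumes "uniform_cantor_data n c" and "w \<in> words n k"
  shows "len (cyl n c w) = delta n c k"
  using cyl_interval[OF assms] by (auto simp: len_def)

lemma cyl_left_to_right:
  assumes "uniform_cantor_data n c" and "w \<in> words n k" and "i < j"
    and "x \<in> cyl n c (w @ [i])" and "y \<in> cyl n c (w @ [j])"
  shows "x < y"
proof -
  obtain a b where ab: "a < b" "cyl n c w = {a..b}"
    using cyl_interval[OF assms(1,2)] by blast
  have data: "2 \<le> n (Suc k)" "0 < c (Suc k)" "(real (n (Suc k)) - 1) * c (Suc k) < 1"
    using assms(1) by (auto simp: uniform_cantor_data_def)
  show ?thesis
    using subdivide(2)[OF data ab(1) assms(3)] assms(4,5) ab(2) length_words[OF assms(2)]
    by auto
qed

lemma cyl_child_subset:
  assumes "uniform_cantor_data n c" and "w \<in> words n k" and "i \<in> {1..n (Suc k)}"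
  shows "cyl n c (w @ [i]) \<subseteq> cyl n c w"
proof -
  obtain a b where ab: "a < b" "cyl n c w = {a..b}"
    using cyl_interval[OF assms(1,2)] by blast
  have data: "2 \<le> n (Suc k)" "0 < c (Suc k)" "(real (n (Suc k)) - 1) * c (Suc k) < 1"
    using assms(1) by (auto simp: uniform_cantor_data_def)
  show ?thesis
    using subdivide(3)[OF data ab(1) assms(3)] ab(2) length_words[OF assms(2)] by auto
qed

lemma cyl_disjoint:
  assumes "uniform_cantor_data n c" and "w \<in> words n k" and "v \<in> words n k" and "w \<noteq> v"
  shows "cyl n c w \<inter> cyl n c v = {}"
  using assms(2-4)
proof (induction k arbitrary: w v)
  case 0
  then show ?case by simp
next
  case (Suc k)
  obtain w' i where w: "w' \<in> words n k" "i \<in> {1..n (Suc k)}" "w = w' @ [i]"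
    using Suc.prems(1) by (auto simp: words_Suc)
  obtain v' j where v: "v' \<in> words n k" "j \<in> {1..n (Suc k)}" "v = v' @ [j]"
    using Suc.prems(2) by (auto simp: words_Suc)
  show ?case
  proof (cases "w' = v'")
    case True
    then have "i < j \<or> j < i" using Suc.prems(3) w v by auto
    then show ?thesis
      using cyl_left_to_right[OF assms(1) w(1)] w(3) v(3) True by (meson disjoint_iff less_irrefl)
  next
    case False
    then show ?thesis
      using Suc.IH[OF w(1) v(1)] cyl_child_subset[OF assms(1) w(1,2)]
        cyl_child_subset[OF assms(1) v(1,2)] w(3) v(3) by blast
  qed
qed

lemma components_Union_finite_disjoint:
  fixes A :: "'a::topological_space set set"
  assumes fin: "finite A" and disj: "disjoint A"
    and A: "\<And>S. S \<in> A \<Longrightarrow> closed S \<and> connected S \<and> S \<noteq> {}"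
  shows "components (\<Union>A) = A"
proof -
  have comp: "connected_component_set (\<Union>A) x = S" if S: "S \<in> A" and x: "x \<in> S" for S x
  proof
    let ?T = "connected_component_set (\<Union>A) x"
    have sub: "?T \<subseteq> S \<union> \<Union>(A - {S})" using connected_component_subset[of "\<Union>A" x] by blast
    have cl: "closed S" "closed (\<Union>(A - {S}))" using A S fin by (auto intro: closed_Union)
    have dis: "S \<inter> \<Union>(A - {S}) = {}" using disj S by (fastforce simp: disjoint_def)
    have xT: "x \<in> ?T" using S x by (auto simp: connected_component_refl_eq)
    have "S \<inter> \<Union>(A - {S}) \<inter> ?T = {}" using dis by blast
    from connected_closedD[OF connected_connected_component[of "\<Union>A" x] this sub cl]
    have "S \<inter> ?T = {} \<or> \<Union>(A - {S}) \<inter> ?T = {}" .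
    then have "\<Union>(A - {S}) \<inter> ?T = {}" using x xT by blast
    then show "?T \<subseteq> S" using sub by blast
  next
    show "S \<subseteq> connected_component_set (\<Union>A) x"
      using A S x by (intro connected_component_maximal) auto
  qed
  show ?thesis
  proof (intro equalityI subsetI)
    fix S assume "S \<in> components (\<Union>A)"
    then obtain x where "x \<in> \<Union>A" and S: "S = connected_component_set (\<Union>A) x"
      by (auto simp: components_def)
    then show "S \<in> A" using comp by auto
  next
    fix S assume S: "S \<in> A"
    then obtain x where "x \<in> S" using A by blast
    then show "S \<in> components (\<Union>A)" using comp S by (auto simp: components_def)
  qed
qed

lemma components_Union_cyl:
  assumes "uniform_cantor_data n c"
  shows "components (\<Union>w\<in>words n k. cyl n c w) = cyl n c ` words n k"
proof (rule components_Union_finite_disjoint)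
  show "finite (cyl n c ` words n k)" using finite_words by blast
  show "disjoint (cyl n c ` words n k)"
    unfolding disjoint_def using cyl_disjoint[OF assms] by blast
  show "closed S \<and> connected S \<and> S \<noteq> {}" if "S \<in> cyl n c ` words n k" for S
    using that cyl_interval[OF assms] by fastforce
qed

lemma level_eq_Union_cyl:
  assumes "uniform_cantor_data n c"
  shows "level n c k = (\<Union>w\<in>words n k. cyl n c w)"
proof (induction k)
  case 0
  show ?case by simp
next
  case (Suc k)
  let ?N = "n (Suc k)" and ?c = "c (Suc k)"
  let ?G = "\<lambda>w. \<Union>i\<in>{1..<?N}. gap ?N ?c (cyl n c w) i"
  have data: "2 \<le> ?N" "0 < ?c" "(real ?N - 1) * ?c < 1"
    using assms by (auto simp: uniform_cantor_data_def)
  have sub: "?G w \<subseteq> cyl n c w" if w: "w \<in> words n k" for w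
  proof -
    obtain a b where ab: "a < b" "cyl n c w = {a..b}"
      using cyl_interval[OF assms w] by blast
    show ?thesis unfolding ab(2) using subdivide(4)[OF data ab(1)] by (intro UN_least)
  qed
  have dif: "cyl n c w - ?G w = (\<Union>i\<in>{1..?N}. cyl n c (w @ [i]))" if w: "w \<in> words n k" for w
  proof -
    obtain a b where ab: "a < b" "cyl n c w = {a..b}"
      using cyl_interval[OF assms w] by blast
    show ?thesis using subdivide(5)[OF data ab(1)] ab(2) length_words[OF w] by simp
  qed
  have "level n c (Suc k) = (\<Union>w\<in>words n k. cyl n c w) - (\<Union>w\<in>words n k. ?G w)"
    by (simp add: Suc.IH components_Union_cyl[OF assms])
  also have "\<dots> = (\<Union>w\<in>words n k. cyl n c w - ?G w)"
  proof (intro equalityI subsetI)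
    fix x assume "x \<in> (\<Union>w\<in>words n k. cyl n c w - ?G w)"
    then obtain w where w: "w \<in> words n k" "x \<in> cyl n c w" "x \<notin> ?G w" by blast
    have "x \<notin> ?G v" if v: "v \<in> words n k" for v
    proof (cases "v = w")
      case True
      then show ?thesis using w(3) by simp
    next
      case False
      then show ?thesis using sub[OF v] cyl_disjoint[OF assms v w(1)] w(2) by blast
    qed
    then show "x \<in> (\<Union>w\<in>words n k. cyl n c w) - (\<Union>w\<in>words n k. ?G w)"
      using w by blast
  qed blast
  also have "\<dots> = (\<Union>w\<in>words n k. \<Union>i\<in>{1..?N}. cyl n c (w @ [i]))"
    using dif by (intro SUP_cong) auto
  also have "\<dots> = (\<Union>w\<in>words n (Suc k). cyl n c w)"
    by (auto simp: words_Suc simp del: cyl_snoc)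
  finally show ?case .
qed

theorem components_level:
  assumes "uniform_cantor_data n c"
  shows "components (level n c k) = cyl n c ` words n k"
  using level_eq_Union_cyl[OF assms] components_Union_cyl[OF assms] by simp

theorem components_level_within:
  assumes "uniform_cantor_data n c" and w: "w \<in> words n k"
  shows "{I \<in> components (level n c (Suc k)). I \<subseteq> cyl n c w}
       = (\<lambda>i. cyl n c (w @ [i])) ` {1..n (Suc k)}"
proof (intro equalityI subsetI)
  fix I assume "I \<in> {I \<in> components (level n c (Suc k)). I \<subseteq> cyl n c w}"
  then obtain v i where v: "v \<in> words n k" "i \<in> {1..n (Suc k)}"
    and I: "I = cyl n c (v @ [i])" and sub: "I \<subseteq> cyl n c w"
    unfolding components_level[OF assms(1)] words_Suc by (auto simp del: cyl_snoc)
  have "v @ [i] \<in> words n (Suc k)" using v by (auto simp: words_Suc)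
  then have "I \<noteq> {}" using cyl_interval[OF assms(1), of "v @ [i]" "Suc k"] I by auto
  then have "v = w"
    using cyl_child_subset[OF assms(1) v] cyl_disjoint[OF assms(1) v(1) w] I sub by blast
  then show "I \<in> (\<lambda>i. cyl n c (w @ [i])) ` {1..n (Suc k)}" using I v by blast
next
  fix I assume "I \<in> (\<lambda>i. cyl n c (w @ [i])) ` {1..n (Suc k)}"
  then obtain i where i: "i \<in> {1..n (Suc k)}" and I: "I = cyl n c (w @ [i])" by blast
  have "w @ [i] \<in> words n (Suc k)" using w i by (auto simp: words_Suc)
  then show "I \<in> {I \<in> components (level n c (Suc k)). I \<subseteq> cyl n c w}"
    using cyl_child_subset[OF assms(1) w i] I
    unfolding components_level[OF assms(1)] by blast
qed

lemma delta_pos: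
  assumes "uniform_cantor_data n c"
  shows "0 < delta n c k"
  unfolding delta_def using assms
  by (intro prod_pos) (force simp: uniform_cantor_data_def)

lemma delta_Suc_le:
  assumes "uniform_cantor_data n c"
  shows "delta n c (Suc k) \<le> delta n c k / 2"
proof -
  let ?N = "n (Suc k)" and ?c = "c (Suc k)"
  have data: "2 \<le> ?N" "0 < ?c" "(real ?N - 1) * ?c < 1"
    using assms by (auto simp: uniform_cantor_data_def)
  have "0 \<le> (real ?N - 1) * ?c" using data by simp
  moreover have "2 \<le> real ?N" using data by simp
  ultimately have "1 - (real ?N - 1) * ?c \<le> 1 / 2 * real ?N" by linarith
  then have "(1 - (real ?N - 1) * ?c) / real ?N \<le> 1 / 2"
    using data by (subst pos_divide_le_eq) auto
  then have "delta n c (Suc k) \<le> delta n c k * (1 / 2)"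
    unfolding delta_Suc using delta_pos[OF assms, of k] by (intro mult_left_mono) auto
  then show ?thesis by simp
qed

lemma delta_antimono:
  assumes "uniform_cantor_data n c" and "j \<le> k"
  shows "delta n c k \<le> delta n c j"
proof (rule lift_Suc_antimono_le[OF _ assms(2)])
  show "delta n c (Suc k) \<le> delta n c k" for k
    using delta_Suc_le[OF assms(1), of k] delta_pos[OF assms(1), of k] by simp
qed

lemma delta_le_half_power:
  assumes "uniform_cantor_data n c"
  shows "delta n c k \<le> (1 / 2) ^ k"
proof (induction k)
  case (Suc k)
  then show ?case using delta_Suc_le[OF assms, of k] by simp
qed simp

lemma mm_ex1:
  assumes data: "uniform_cantor_data n c" and k: "k \<in> Lambda n c"
  shows "\<exists>!m. 1 \<le> m \<and> delta n c (k + m) \<le> eps n c k \<and> eps n c k < delta n c (k + m - 1)"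
proof -
  have k1: "1 \<le> k" and lt: "eps n c k < delta n c k" using k by (auto simp: Lambda_def)
  have pos: "0 < eps n c k"
    using data k1 delta_pos[OF data] by (auto simp: eps_def uniform_cantor_data_def)
  obtain l where "(1 / 2) ^ l < eps n c k"
    using real_arch_pow_inv[OF pos, of "1 / 2"] by auto
  then have "delta n c (k + l) \<le> eps n c k"
    using delta_le_half_power[OF data, of l] delta_antimono[OF data, of l "k + l"] by simp
  then have ex: "\<exists>m. delta n c (k + m) \<le> eps n c k" by blast
  define m where "m = (LEAST m. delta n c (k + m) \<le> eps n c k)"
  have m: "delta n c (k + m) \<le> eps n c k" unfolding m_def using ex by (rule LeastI_ex)
  have m1: "1 \<le> m" using m lt by (cases m) auto
  have "\<not> delta n c (k + (m - 1)) \<le> eps n c k"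
    using m1 not_less_Least[of "m - 1" "\<lambda>m. delta n c (k + m) \<le> eps n c k"]
    by (simp add: m_def)
  then have m2: "eps n c k < delta n c (k + m - 1)" using m1 by simp
  show ?thesis
  proof (rule ex1I[of _ m])
    fix m'
    assume m': "1 \<le> m' \<and> delta n c (k + m') \<le> eps n c k \<and> eps n c k < delta n c (k + m' - 1)"
    have "\<not> m < m'"
    proof
      assume "m < m'"
      then have "k + m \<le> k + m' - 1" by simp
      from delta_antimono[OF data this] show False using m m' by simp
    qed
    moreover have "\<not> m' < m"
    proof
      assume "m' < m"
      then have "k + m' \<le> k + m - 1" by simp
      from delta_antimono[OF data this] show False using m2 m' by simp
    qed
    ultimately show "m' = m" by simp
  qed (use m m1 m2 in auto)
qed

lemma mm_props:
  assumes "uniform_cantor_data n c" and "k \<in> Lambda n c"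
  shows "1 \<le> mm n c k" and "delta n c (k + mm n c k) \<le> eps n c k"
    and "eps n c k < delta n c (k + mm n c k - 1)"
  using theI'[OF mm_ex1[OF assms]] by (auto simp: mm_def)

end

theory Submission
  imports Defs
begin

text \<open>
  The measure of a cylinder is the product of the weights of its letters, so two cylinders of level
  \<open>K\<close> that are separated by a single gap, of level \<open>k \<le> K\<close>, carry the words
  \<open>w i n\<^sub>k\<^sub>+\<^sub>1 \<dots> n\<^sub>K\<close> and \<open>w (i+1) 1 \<dots> 1\<close>, and the ratio of their measures is
  \<open>P k i / P k (i+1)\<close> times the ratio of the two products in (b) with \<open>t = K - k\<close>. For \<open>k\<close> in
  \<open>Lambda n c\<close>, the restriction \<open>t < mm n c k\<close> says exactly that the gap is shorter than the cylinders. Thus (a)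
  compares siblings, and together with (b) it compares neighbouring cylinders of equal level
  whenever the gap between them is shorter than they are.

  Sufficiency: if \<open>\<delta> (K + 1) < 2 * r \<le> \<delta> K\<close>, then a ball of radius \<open>2 * r\<close> meets at most three
  cylinders of level \<open>K\<close>, across gaps shorter than \<open>\<delta> K\<close>, so its measure is at most a constant times
  that of the cylinder of level \<open>K\<close> around its centre. The ball of radius \<open>r\<close> contains the cylinder of
  level \<open>K + 2\<close> around the centre, and (a) with bounded branching bounds all weights from below.

  Necessity: doubling compares cylinders that lie in comparable balls, but a ball inside a given
  cylinder may be forced to be much smaller than the cylinder, because the points of the set may
  all lie near its two ends, close to the neighbouring cylinders. The following overcomes this.
  At the ends of \<open>[0, 1]\<close> there are no neighbours, which bounds the first and the last weight of each
  level from below (\<open>P_first_ge\<close>, \<open>P_last_ge\<close>). If the gaps of level \<open>k\<close> are at least as long as the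
  cylinders, balls isolate the inner children, and (a) is immediate (\<open>P_ge_if_wide_gap\<close>). If they are
  shorter, a ball whose radius is the length of a gap, centred at one end of the gap, sees only one
  side of it, which compares \<open>P k i * G\<close> with \<open>P k (i+1) * F\<close>, where \<open>F\<close>, \<open>G\<close> are the products
  in (b) for the largest \<open>t\<close> (\<open>across_gap\<close>). The weights \<open>P k i\<close> are therefore, up to constants, a
  geometric progression in \<open>i\<close> whose two ends are comparable; so its ratio is bounded, and this is
  (a). Finally (b) follows for every \<open>t\<close>: a ball of radius \<open>\<delta> (k + t)\<close> centred at the far end of the
  cylinder on one side of the gap meets only that cylinder and its sibling, which by (a) is no
  heavier up to a constant (\<open>cousins_comparable\<close>).
\<close>


section \<open>Endpoints of the basic intervals\<close>

lemma snoc_in_words: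
  "w \<in> words n k \<Longrightarrow> i \<in> {1..n (Suc k)} \<Longrightarrow> w @ [i] \<in> words n (Suc k)"
  by (force simp: words_Suc)

text \<open>
  Appending \<open>rights n k t\<close> to a word of length \<open>k\<close> descends \<open>t\<close> times into the rightmost child, and
  appending \<open>lefts t\<close> descends into the leftmost one; these words describe the two sides of a gap.
\<close>

definition rights :: "(nat \<Rightarrow> nat) \<Rightarrow> nat \<Rightarrow> nat \<Rightarrow> nat list" where
  "rights n k t = map n [Suc k..<Suc (k + t)]"

abbreviation lefts :: "nat \<Rightarrow> nat list" where
  "lefts t \<equiv> replicate t 1"

lemma rights_0 [simp]: "rights n k 0 = []"
  by (simp add: rights_def)

lemma rights_Suc: "rights n k (Suc t) = rights n k t @ [n (Suc (k + t))]"
  by (simp add: rights_def)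

lemma lefts_Suc: "lefts (Suc t) = lefts t @ [1]"
  by (simp add: replicate_append_same)

locale uniform_cantor =
  fixes n :: "nat \<Rightarrow> nat" and c :: "nat \<Rightarrow> real"
  assumes data: "uniform_cantor_data n c"
begin

declare cyl_snoc [simp del]

abbreviation "E \<equiv> cantor_set n c"
abbreviation "\<delta> \<equiv> delta n c"
abbreviation "\<epsilon> \<equiv> eps n c"
abbreviation "I \<equiv> cyl n c"
abbreviation "W \<equiv> words n"

definition lft :: "nat list \<Rightarrow> real" where "lft w = Inf (I w)"
definition rgt :: "nat list \<Rightarrow> real" where "rgt w = Sup (I w)"

lemma branching: "k \<ge> 1 \<Longrightarrow> 2 \<le> n k"
  using data by (auto simp: uniform_cantor_data_def)

lemma \<delta>_pos: "0 < \<delta> k"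
  by (rule delta_pos[OF data])

lemma \<epsilon>_pos: "k \<ge> 1 \<Longrightarrow> 0 < \<epsilon> k"
  using data \<delta>_pos by (auto simp: eps_def uniform_cantor_data_def)

lemma cyl_eq:
  assumes "w \<in> W k"
  shows "I w = {lft w..rgt w}" and "rgt w = lft w + \<delta> k"
proof -
  obtain a b where ab: "a < b" "I w = {a..b}" "b - a = \<delta> k"
    using cyl_interval[OF data assms] by blast
  have "lft w = a" "rgt w = b" unfolding lft_def rgt_def ab(2) using ab(1) by simp_all
  with ab show "I w = {lft w..rgt w}" and "rgt w = lft w + \<delta> k" by simp_all
qed

lemma \<delta>_split: "\<delta> k = real (n (Suc k)) * \<delta> (Suc k) + (real (n (Suc k)) - 1) * \<epsilon> (Suc k)"
  using branching[of "Suc k"] by (simp add: delta_Suc eps_def field_simps)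

lemma lft_snoc:
  assumes w: "w \<in> W k"
  shows "lft (w @ [i]) = lft w + (real i - 1) * (\<delta> (Suc k) + \<epsilon> (Suc k))"
proof -
  let ?N = "n (Suc k)" and ?c = "c (Suc k)"
  have r: "rem_len ?N ?c (I w) = \<delta> (Suc k)"
    using len_cyl[OF data w] by (simp add: rem_len_def delta_Suc)
  have "I (w @ [i]) = {child_left ?N ?c (I w) i .. child_left ?N ?c (I w) i + \<delta> (Suc k)}"
    by (simp add: cyl_snoc length_words[OF w] child_def r)
  then have "lft (w @ [i]) = child_left ?N ?c (I w) i"
    using \<delta>_pos[of "Suc k"] by (simp add: lft_def)
  then show ?thesis
    using len_cyl[OF data w] by (simp add: child_left_def r lft_def eps_def)
qed

lemma lft_snoc_1 [simp]: "w \<in> W k \<Longrightarrow> lft (w @ [Suc 0]) = lft w"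
  by (simp add: lft_snoc)

lemma lft_snoc_Suc:
  assumes w: "w \<in> W k" and i: "i \<in> {1..n (Suc k)}"
  shows "lft (w @ [Suc i]) = rgt (w @ [i]) + \<epsilon> (Suc k)"
  using lft_snoc[OF w, of i] lft_snoc[OF w, of "Suc i"] cyl_eq(2)[OF snoc_in_words[OF w i]]
  by (simp add: algebra_simps)

lemma rgt_snoc:
  assumes w: "w \<in> W k" and i: "i \<in> {1..n (Suc k)}"
  shows "rgt (w @ [i]) = rgt w - (real (n (Suc k)) - real i) * (\<delta> (Suc k) + \<epsilon> (Suc k))"
  using cyl_eq(2)[OF w] cyl_eq(2)[OF snoc_in_words[OF w i]] lft_snoc[OF w, of i] \<delta>_split[of k]
  by (simp add: algebra_simps)

lemma rgt_snoc_n [simp]: "w \<in> W k \<Longrightarrow> rgt (w @ [n (Suc k)]) = rgt w"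
  using branching[of "Suc k"] by (simp add: rgt_snoc)

lemma snoc_mono:
  assumes w: "w \<in> W k" and ij: "i \<le> j" "i \<in> {1..n (Suc k)}" "j \<in> {1..n (Suc k)}"
  shows "lft (w @ [i]) \<le> lft (w @ [j])" and "rgt (w @ [i]) \<le> rgt (w @ [j])"
proof -
  have "(real i - 1) * (\<delta> (Suc k) + \<epsilon> (Suc k)) \<le> (real j - 1) * (\<delta> (Suc k) + \<epsilon> (Suc k))"
    using ij \<delta>_pos[of "Suc k"] \<epsilon>_pos[of "Suc k"] by (intro mult_right_mono) auto
  then show l: "lft (w @ [i]) \<le> lft (w @ [j])" by (simp add: lft_snoc[OF w])
  show "rgt (w @ [i]) \<le> rgt (w @ [j])"
    using l cyl_eq(2)[OF snoc_in_words[OF w ij(2)]] cyl_eq(2)[OF snoc_in_words[OF w ij(3)]] by simp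
qed

lemma lft_le_snoc: "w \<in> W k \<Longrightarrow> i \<in> {1..n (Suc k)} \<Longrightarrow> lft w \<le> lft (w @ [i])"
  using snoc_mono(1)[of w k 1 i] by simp

lemma rgt_snoc_le: "w \<in> W k \<Longrightarrow> i \<in> {1..n (Suc k)} \<Longrightarrow> rgt (w @ [i]) \<le> rgt w"
  using snoc_mono(2)[of w k i "n (Suc k)"] by simp

text \<open>
  The end of an interval survives all subdivisions. This makes the ends points of the Cantor set,
  hence admissible centres of balls.
\<close>

lemma append_lefts:
  assumes "w \<in> W k"
  shows "w @ lefts t \<in> W (k + t)" and "lft (w @ lefts t) = lft w"
proof (induction t)
  case (Suc t)
  {
    case 1
    show ?case
      using snoc_in_words[OF Suc(1), of 1] branching[of "Suc (k + t)"]
      unfolding lefts_Suc by simp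
  next
    case 2
    show ?case
      using lft_snoc_1[OF Suc(1)] Suc(2) unfolding lefts_Suc by simp
  }
qed (use assms in auto)

lemma append_rights:
  assumes "w \<in> W k"
  shows "w @ rights n k t \<in> W (k + t)" and "rgt (w @ rights n k t) = rgt w"
proof (induction t)
  case (Suc t)
  {
    case 1
    show ?case
      using snoc_in_words[OF Suc(1), of "n (Suc (k + t))"] branching[of "Suc (k + t)"]
      unfolding rights_Suc by simp
  next
    case 2
    show ?case
      using rgt_snoc_n[OF Suc(1)] Suc(2) unfolding rights_Suc by simp
  }
qed (use assms in auto)


section \<open>Points of the Cantor set\<close>

lemma level_antimono: "j \<le> k \<Longrightarrow> level n c k \<subseteq> level n c j"
  by (rule lift_Suc_antimono_le[of "level n c"]) auto

lemma in_cantor_setI: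
  assumes "\<And>t. x \<in> level n c (k + t)"
  shows "x \<in> E"
  unfolding cantor_set_def
proof
  fix j
  show "x \<in> level n c j" using assms[of j] level_antimono[of j "k + j"] by auto
qed

lemma lft_in_E: assumes w: "w \<in> W k" shows "lft w \<in> E"
proof (rule in_cantor_setI)
  fix t
  have "lft w \<in> I (w @ lefts t)"
    using append_lefts[OF w, of t] cyl_eq[OF append_lefts(1)[OF w, of t]] \<delta>_pos[of "k + t"] by simp
  then show "lft w \<in> level n c (k + t)"
    using append_lefts(1)[OF w] level_eq_Union_cyl[OF data] by blast
qed

lemma rgt_in_E: assumes w: "w \<in> W k" shows "rgt w \<in> E"
proof (rule in_cantor_setI)
  fix t
  have "rgt w \<in> I (w @ rights n k t)"
    using append_rights[OF w, of t] cyl_eq[OF append_rights(1)[OF w, of t]] \<delta>_pos[of "k + t"]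
    by simp
  then show "rgt w \<in> level n c (k + t)"
    using append_rights(1)[OF w] level_eq_Union_cyl[OF data] by blast
qed

lemma E_subset_unit: "E \<subseteq> {0..1}"
proof
  fix x assume "x \<in> E"
  then have "x \<in> level n c 0" unfolding cantor_set_def by blast
  then show "x \<in> {0..1}" by simp
qed

lemma E_in_cyl: assumes "x \<in> E" obtains w where "w \<in> W k" "x \<in> I w"
  using assms level_eq_Union_cyl[OF data, of k] unfolding cantor_set_def by blast

lemma E_in_child:
  assumes "x \<in> E" "w \<in> W k" "x \<in> I w"
  obtains i where "i \<in> {1..n (Suc k)}" "x \<in> I (w @ [i])"
proof -
  obtain v where v: "v \<in> W (Suc k)" "x \<in> I v" using E_in_cyl[OF assms(1)] .
  then obtain u i where u: "u \<in> W k" "i \<in> {1..n (Suc k)}" "v = u @ [i]" by (auto simp: words_Suc)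
  then have "x \<in> I u" using cyl_child_subset[OF data u(1,2)] v by blast
  then have "u = w" using cyl_disjoint[OF data u(1) assms(2)] assms(3) by blast
  with u v that show thesis by blast
qed

lemma gap_avoided:
  assumes "y \<in> E" "w \<in> W k" "1 \<le> i" "i < n (Suc k)" "rgt (w @ [i]) < y"
  shows "lft (w @ [Suc i]) \<le> y"
proof (rule ccontr)
  assume less: "\<not> ?thesis"
  have i: "i \<in> {1..n (Suc k)}" "Suc i \<in> {1..n (Suc k)}" using assms by auto
  have "y \<in> I w"
    using less assms(5) cyl_eq[OF assms(2)] lft_le_snoc[OF assms(2) i(1)]
      rgt_snoc_le[OF assms(2) i(2)] \<delta>_pos[of "Suc k"]
      cyl_eq(2)[OF snoc_in_words[OF assms(2) i(1)]] cyl_eq(2)[OF snoc_in_words[OF assms(2) i(2)]]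
    by auto
  then obtain j where j: "j \<in> {1..n (Suc k)}" "y \<in> I (w @ [j])"
    using E_in_child assms(1,2) by blast
  then have y: "lft (w @ [j]) \<le> y" "y \<le> rgt (w @ [j])"
    using cyl_eq(1)[OF snoc_in_words[OF assms(2) j(1)]] by auto
  show False
  proof (cases "j \<le> i")
    case True
    then show False using snoc_mono(2)[OF assms(2) True j(1) i(1)] y assms(5) by simp
  next
    case False
    then show False using snoc_mono(1)[OF assms(2) _ i(2) j(1)] y less by simp
  qed
qed

lemma near_first_child:
  assumes "y \<in> E" "w \<in> W k" "lft w \<le> y" "y < lft w + \<delta> (Suc k) + \<epsilon> (Suc k)"
  shows "y \<in> I (w @ [1])"
proof -
  have i: "1 \<in> {1..n (Suc k)}" "1 < n (Suc k)" using branching[of "Suc k"] by auto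
  have "\<not> rgt (w @ [1]) < y"
    using gap_avoided[OF assms(1,2) _ i(2)] lft_snoc[OF assms(2), of 2] assms(4)
    by (auto simp: numeral_2_eq_2)
  then show ?thesis
    using cyl_eq(1)[OF snoc_in_words[OF assms(2) i(1)]] assms by simp
qed

lemma near_last_child:
  assumes "y \<in> E" "w \<in> W k" "y \<le> rgt w" "rgt w - \<delta> (Suc k) - \<epsilon> (Suc k) < y"
  shows "y \<in> I (w @ [n (Suc k)])"
proof -
  let ?N = "n (Suc k)"
  have i: "?N \<in> {1..?N}" "1 \<le> ?N - 1" "?N - 1 < ?N" "?N - 1 \<in> {1..?N}" "Suc (?N - 1) = ?N"
    using branching[of "Suc k"] by auto
  have "rgt (w @ [?N - 1]) < y"
    using rgt_snoc[OF assms(2) i(4)] assms(4) branching[of "Suc k"] by (simp add: of_nat_diff)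
  then have "lft (w @ [?N]) \<le> y"
    using gap_avoided[OF assms(1,2) i(2,3)] i(5) by simp
  then show ?thesis
    using cyl_eq(1)[OF snoc_in_words[OF assms(2) i(1)]] assms by simp
qed

text \<open>
  For the comparisons across short gaps the centre is put at the end of a cylinder that faces away
  from the gap; what else the ball can meet there is a sibling, at the same level of the same parent.
\<close>

lemma near_lft_last_child:
  assumes "y \<in> E" "w \<in> W k" "\<bar>y - lft (w @ [n (Suc k)])\<bar> < \<delta> (Suc k)"
  shows "y \<in> I (w @ [n (Suc k)]) \<union> I (w @ [n (Suc k) - 1])"
proof -
  let ?N = "n (Suc k)"
  have i: "?N \<in> {1..?N}" "1 \<le> ?N - 1" "?N - 1 < ?N" "?N - 1 \<in> {1..?N}" "Suc (?N - 1) = ?N"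
    using branching[of "Suc k"] by auto
  note w' = snoc_in_words[OF assms(2) i(1)] snoc_in_words[OF assms(2) i(4)]
  have "lft (w @ [?N - 1]) + \<delta> (Suc k) + \<epsilon> (Suc k) = lft (w @ [?N])"
    using lft_snoc_Suc[OF assms(2) i(4)] i(5) cyl_eq(2)[OF w'(2)] by simp
  then show ?thesis
    using gap_avoided[OF assms(1,2) i(2,3)] cyl_eq[OF w'(1)] cyl_eq[OF w'(2)] assms(3) i(5)
      \<epsilon>_pos[of "Suc k"]
    by (cases "rgt (w @ [?N - 1]) < y") auto
qed

lemma near_rgt_first_child:
  assumes "y \<in> E" "w \<in> W k" "\<bar>y - rgt (w @ [1])\<bar> < \<delta> (Suc k)"
  shows "y \<in> I (w @ [1]) \<union> I (w @ [2])"
proof -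
  let ?N = "n (Suc k)"
  have i: "1 \<in> {1..?N}" "1 < ?N" "2 \<in> {1..?N}"
    using branching[of "Suc k"] by auto
  note w' = snoc_in_words[OF assms(2) i(1)] snoc_in_words[OF assms(2) i(3)]
  have "lft (w @ [2]) = rgt (w @ [1]) + \<epsilon> (Suc k)"
    using lft_snoc_Suc[OF assms(2) i(1)] by (simp add: numeral_2_eq_2)
  then show ?thesis
    using gap_avoided[OF assms(1,2) _ i(2)] cyl_eq[OF w'(1)] cyl_eq[OF w'(2)] assms(3)
      \<epsilon>_pos[of "Suc k"]
    by (cases "rgt (w @ [1]) < y") (auto simp: numeral_2_eq_2)
qed

lemma cyl_separated:
  assumes "u \<in> W K" "v \<in> W K" "u \<noteq> v" "x \<in> I u" "y \<in> I v" "x < y"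
  shows "rgt u < y" and "x < lft v"
proof -
  have "y \<notin> I u" "x \<notin> I v"
    using cyl_disjoint[OF data assms(1-3)] assms(4,5) by blast+
  then show "rgt u < y" and "x < lft v"
    using assms(4-6) cyl_eq(1)[OF assms(1)] cyl_eq(1)[OF assms(2)] by auto
qed

text \<open>
  Points in different cylinders that are closer than the length of a cylinder leave no room for a
  third cylinder between them. Going down the tree, the letters of the two words must therefore
  differ by one where they first differ, and from there on follow the two sides of the gap.
\<close>

lemma close_cylinders_adjacent:
  assumes "u \<in> W K" "v \<in> W K" "u \<noteq> v" "x \<in> I u" "y \<in> I v" "x < y" "y < x + \<delta> K"
  shows "\<exists>k t w i. K = Suc k + t \<and> w \<in> W k \<and> 1 \<le> i \<and> i < n (Suc k) \<and>
           u = (w @ [i]) @ rights n (Suc k) t \<and> v = (w @ [Suc i]) @ lefts t"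
  using assms
proof (induction K arbitrary: u v)
  case 0
  then show ?case by simp
next
  case (Suc K)
  obtain u' i where u: "u' \<in> W K" "i \<in> {1..n (Suc K)}" "u = u' @ [i]"
    using Suc.prems(1) by (auto simp: words_Suc)
  obtain v' j where v: "v' \<in> W K" "j \<in> {1..n (Suc K)}" "v = v' @ [j]"
    using Suc.prems(2) by (auto simp: words_Suc)
  have xy: "lft u \<le> x" "x \<le> rgt u" "lft v \<le> y" "y \<le> rgt v"
    using Suc.prems(4,5) cyl_eq(1)[OF Suc.prems(1)] cyl_eq(1)[OF Suc.prems(2)] by auto
  have len: "rgt u = lft u + \<delta> (Suc K)" "rgt v = lft v + \<delta> (Suc K)"
    using cyl_eq(2)[OF Suc.prems(1)] cyl_eq(2)[OF Suc.prems(2)] by auto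
  have ep: "0 < \<epsilon> (Suc K)" and dp: "0 < \<delta> (Suc K)" using \<epsilon>_pos \<delta>_pos by auto
  show ?case
  proof (cases "u' = v'")
    case True
    have "i < j"
      using cyl_left_to_right[OF data u(1), of j i y x] Suc.prems(3-6) u v True
      by (metis linorder_neqE_nat not_less_iff_gr_or_eq)
    moreover have "\<not> Suc i < j"
    proof
      assume "Suc i < j"
      then have "real i + 2 \<le> real j" by linarith
      then have "(real i + 1) * (\<delta> (Suc K) + \<epsilon> (Suc K)) \<le> (real j - 1) * (\<delta> (Suc K) + \<epsilon> (Suc K))"
        using ep dp by (intro mult_right_mono) auto
      then have "lft u + 2 * (\<delta> (Suc K) + \<epsilon> (Suc K)) \<le> lft v"
        using u v True lft_snoc[OF u(1), of i] lft_snoc[OF u(1), of j] by (simp add: algebra_simps)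
      then show False using xy len Suc.prems(7) ep dp by simp
    qed
    ultimately have "j = Suc i" by simp
    then show ?thesis
      using u v True by (intro exI[of _ K] exI[of _ 0] exI[of _ u'] exI[of _ i]) auto
  next
    case False
    have x': "x \<in> I u'" and y': "y \<in> I v'"
      using cyl_child_subset[OF data u(1,2)] cyl_child_subset[OF data v(1,2)]
        Suc.prems(4,5) u v by blast+
    have "y < x + \<delta> K"
      using Suc.prems(7) delta_antimono[OF data, of K "Suc K"] by simp
    from Suc.IH[OF u(1) v(1) False x' y' Suc.prems(6) this]
    obtain k t w l where kt: "K = Suc k + t" "w \<in> W k" "1 \<le> l" "l < n (Suc k)"
      "u' = (w @ [l]) @ rights n (Suc k) t" "v' = (w @ [Suc l]) @ lefts t" by blast
    have sep: "rgt u' < y" "x < lft v'"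
      using cyl_separated[OF u(1) v(1) False x' y' Suc.prems(6)] by auto
    \<comment> \<open>Otherwise a whole sibling of \<open>u\<close> would fit between \<open>x\<close> and \<open>y\<close>; likewise for \<open>v\<close> below.\<close>
    have "i = n (Suc K)"
    proof (rule ccontr)
      assume "i \<noteq> n (Suc K)"
      then have "1 * (\<delta> (Suc K) + \<epsilon> (Suc K))
        \<le> (real (n (Suc K)) - real i) * (\<delta> (Suc K) + \<epsilon> (Suc K))"
        using ep dp u(2) by (intro mult_right_mono) auto
      then show False
        using rgt_snoc[OF u(1,2)] u(3) xy sep Suc.prems(7) ep by simp
    qed
    moreover have "j = 1"
    proof (rule ccontr)
      assume "j \<noteq> 1"
      then have "1 * (\<delta> (Suc K) + \<epsilon> (Suc K)) \<le> (real j - 1) * (\<delta> (Suc K) + \<epsilon> (Suc K))"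
        using ep dp v(2) by (intro mult_right_mono) auto
      then show False
        using lft_snoc[OF v(1), of j] v(3) xy sep Suc.prems(7) ep by simp
    qed
    ultimately show ?thesis
      using kt u v
      by (intro exI[of _ k] exI[of _ "Suc t"] exI[of _ w] exI[of _ l])
        (auto simp: rights_Suc replicate_append_same[symmetric])
  qed
qed

text \<open>
  On either side of the centre's cylinder a second neighbour lies behind the first one, whose
  length alone is at least the radius.
\<close>

lemma ball_meets_at_most_three:
  assumes u: "u \<in> W K" and x: "x \<in> I u" and r: "r \<le> \<delta> K"
  defines "S \<equiv> {v \<in> W K. I v \<inter> ball x r \<noteq> {}}"
  shows "card S \<le> 3"
proof -
  define R where "R = {v \<in> W K. v \<noteq> u \<and> (\<exists>y\<in>I v. x < y \<and> y < x + r)}"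
  define L where "L = {v \<in> W K. v \<noteq> u \<and> (\<exists>y\<in>I v. y < x \<and> x - r < y)}"
  have fin: "finite R" "finite L" using finite_words[of n K] by (auto simp: R_def L_def)
  have notR: False
    if v: "v1 \<in> W K" "v1 \<noteq> u" "y1 \<in> I v1" "x < y1" "v2 \<in> W K" "v1 \<noteq> v2" "y2 \<in> I v2"
      "y2 < x + r" "y1 < y2" for v1 v2 y1 y2
    using cyl_separated(1)[OF v(1,5,6,3,7,9)] cyl_separated(2)[OF u v(1) v(2)[symmetric] x v(3,4)]
      cyl_eq(2)[OF v(1)] r v by simp
  have notL: False
    if v: "v1 \<in> W K" "v1 \<noteq> u" "y1 \<in> I v1" "y1 < x" "v2 \<in> W K" "v2 \<noteq> v1" "y2 \<in> I v2"
      "x - r < y2" "y2 < y1" for v1 v2 y1 y2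
    using cyl_separated(2)[OF v(5,1,6,7,3,9)] cyl_separated(1)[OF v(1) u v(2,3) x v(4)]
      cyl_eq(2)[OF v(1)] r v by simp
  have disj: "y1 \<noteq> y2" if "v1 \<in> W K" "v2 \<in> W K" "v1 \<noteq> v2" "y1 \<in> I v1" "y2 \<in> I v2" for v1 v2 y1 y2
    using cyl_disjoint[OF data that(1-3)] that(4,5) by blast
  have "v1 = v2" if "v1 \<in> R" "v2 \<in> R" for v1 v2
  proof (rule ccontr)
    assume ne: "v1 \<noteq> v2"
    obtain y1 y2 where y: "y1 \<in> I v1" "x < y1" "y1 < x + r" "y2 \<in> I v2" "x < y2" "y2 < x + r"
      and v: "v1 \<in> W K" "v1 \<noteq> u" "v2 \<in> W K" "v2 \<noteq> u"
      using \<open>v1 \<in> R\<close> \<open>v2 \<in> R\<close> by (auto simp: R_def)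
    have "y1 \<noteq> y2" using disj[OF v(1,3) ne y(1,4)] .
    then show False
      using notR[OF v(1,2) y(1,2) v(3) ne y(4,6)] notR[OF v(3,4) y(4,5) v(1) ne[symmetric] y(1,3)]
      by linarith
  qed
  then have cR: "card R \<le> Suc 0" using card_le_Suc0_iff_eq[OF fin(1)] by blast
  have "v1 = v2" if "v1 \<in> L" "v2 \<in> L" for v1 v2
  proof (rule ccontr)
    assume ne: "v1 \<noteq> v2"
    obtain y1 y2 where y: "y1 \<in> I v1" "y1 < x" "x - r < y1" "y2 \<in> I v2" "y2 < x" "x - r < y2"
      and v: "v1 \<in> W K" "v1 \<noteq> u" "v2 \<in> W K" "v2 \<noteq> u"
      using \<open>v1 \<in> L\<close> \<open>v2 \<in> L\<close> by (auto simp: L_def)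
    have "y1 \<noteq> y2" using disj[OF v(1,3) ne y(1,4)] .
    then show False
      using notL[OF v(1,2) y(1,2) v(3) ne[symmetric] y(4,6)] notL[OF v(3,4) y(4,5) v(1) ne y(1,3)]
      by linarith
  qed
  then have cL: "card L \<le> Suc 0" using card_le_Suc0_iff_eq[OF fin(2)] by blast
  have "S \<subseteq> {u} \<union> (R \<union> L)"
  proof
    fix v assume "v \<in> S"
    then obtain y where y: "v \<in> W K" "y \<in> I v" "\<bar>x - y\<bar> < r"
      by (auto simp: S_def dist_real_def)
    show "v \<in> {u} \<union> (R \<union> L)"
    proof (cases "v = u")
      case False
      then have "x \<noteq> y" using disj[OF u y(1) _ x y(2)] by auto
      then consider "x < y" "y < x + r" | "y < x" "x - r < y" using y(3) by linarith
      then show ?thesis using y(1,2) False by cases (auto simp: R_def L_def)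
    qed simp
  qed
  then have "card S \<le> card ({u} \<union> (R \<union> L))" using fin by (intro card_mono) auto
  also have "\<dots> \<le> card {u} + card (R \<union> L)" by (rule card_Un_le)
  also have "\<dots> \<le> card {u} + (card R + card L)" using card_Un_le[of R L] by simp
  finally show ?thesis using cR cL by simp
qed

end


section \<open>Masses of cylinders and balls\<close>

locale cantor_mass = uniform_cantor +
  fixes P :: "nat \<Rightarrow> nat \<Rightarrow> real" and \<mu> :: "real measure"
  assumes matching: "n_matching n P" and cantor_measure: "is_cantor_measure n c P \<mu>"
begin

sublocale prob_space \<mu>
  using cantor_measure by (simp add: is_cantor_measure_def)

lemma sets_\<mu>: "sets \<mu> = sets (restrict_space borel E)"
  using cantor_measure by (simp add: is_cantor_measure_def)

lemma space_\<mu>: "space \<mu> = E"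
  using sets_eq_imp_space_eq[OF sets_\<mu>] by (simp add: space_restrict_space)

lemma borel_Int_E: "A \<in> sets borel \<Longrightarrow> E \<inter> A \<in> sets \<mu>"
  by (auto simp: sets_\<mu> sets_restrict_space)

lemma ball_event: "E \<inter> ball x r \<in> sets \<mu>"
  by (rule borel_Int_E) simp

lemma cyl_event: "w \<in> W k \<Longrightarrow> E \<inter> I w \<in> sets \<mu>"
  by (rule borel_Int_E) (simp add: cyl_eq(1))

lemma P_pos: "k \<ge> 1 \<Longrightarrow> i \<in> {1..n k} \<Longrightarrow> 0 < P k i"
  using matching by (simp add: n_matching_def)

lemma P_sum: "k \<ge> 1 \<Longrightarrow> (\<Sum>i=1..n k. P k i) = 1"
  using matching by (simp add: n_matching_def)

lemma P_le_1: "k \<ge> 1 \<Longrightarrow> i \<in> {1..n k} \<Longrightarrow> P k i \<le> 1"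
  using member_le_sum[of i "{1..n k}" "P k"] P_pos[of k] P_sum[of k] by (auto intro: less_imp_le)

lemma P_first_pos: "0 < P (Suc k) 1" and P_last_pos: "0 < P (Suc k) (n (Suc k))"
  using P_pos branching[of "Suc k"] by auto

definition mass :: "nat list \<Rightarrow> real" where
  "mass w = (\<Prod>j<length w. P (Suc j) (w ! j))"

lemma mass_snoc: "w \<in> W k \<Longrightarrow> mass (w @ [i]) = mass w * P (Suc k) i"
  by (simp add: mass_def length_words nth_append)

lemma prob_cyl: "w \<in> W k \<Longrightarrow> prob (E \<inter> I w) = mass w"
proof (induction k arbitrary: w)
  case 0
  have "E \<inter> {0..1} = space \<mu>" using E_subset_unit by (auto simp: space_\<mu>)
  then show ?case using 0 prob_space by (simp add: mass_def)
next
  case (Suc k)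
  then obtain v i where v: "v \<in> W k" "i \<in> {1..n (Suc k)}" "w = v @ [i]" by (auto simp: words_Suc)
  have "prob (I (v @ [i]) \<inter> E) = P (Suc k) i * prob (I v \<inter> E)"
    using cantor_measure v by (auto simp: is_cantor_measure_def)
  then show ?case using Suc.IH[OF v(1)] v mass_snoc[OF v(1)] by (simp add: Int_commute)
qed

lemma mass_pos: "w \<in> W k \<Longrightarrow> 0 < mass w"
  unfolding mass_def by (intro prod_pos) (auto simp: words_def intro!: P_pos)

lemma mass_append_lefts:
  "w \<in> W k \<Longrightarrow> mass (w @ lefts t) = mass w * (\<Prod>j=1..t. P (k + j) 1)"
proof (induction t)
  case (Suc t)
  have "mass (w @ lefts (Suc t)) = mass ((w @ lefts t) @ [1])" unfolding lefts_Suc by simp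
  also have "\<dots> = mass (w @ lefts t) * P (Suc (k + t)) 1"
    using mass_snoc[OF append_lefts(1)[OF Suc.prems]] .
  finally show ?case using Suc by simp
qed simp

lemma mass_append_rights:
  "w \<in> W k \<Longrightarrow> mass (w @ rights n k t) = mass w * (\<Prod>j=1..t. P (k + j) (n (k + j)))"
proof (induction t)
  case (Suc t)
  have "mass (w @ rights n k (Suc t)) = mass ((w @ rights n k t) @ [n (Suc (k + t))])"
    unfolding rights_Suc by simp
  also have "\<dots> = mass (w @ rights n k t) * P (Suc (k + t)) (n (Suc (k + t)))"
    using mass_snoc[OF append_rights(1)[OF Suc.prems]] .
  finally show ?case using Suc by simp
qed simp

lemma prob_le_sum_mass:
  assumes "A \<in> sets \<mu>" "U \<subseteq> W k" "A \<subseteq> (\<Union>u\<in>U. I u)"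
  shows "prob A \<le> (\<Sum>u\<in>U. mass u)"
proof -
  have fin: "finite U" using assms(2) finite_words finite_subset by blast
  have "A \<subseteq> E" using sets.sets_into_space[OF assms(1)] by (simp add: space_\<mu>)
  then have "A \<subseteq> (\<Union>u\<in>U. E \<inter> I u)" using assms(3) by blast
  moreover have ev: "E \<inter> I u \<in> sets \<mu>" if "u \<in> U" for u using that assms(2) cyl_event by blast
  ultimately have "prob A \<le> prob (\<Union>u\<in>U. E \<inter> I u)"
    using fin ev by (intro finite_measure_mono sets.finite_UN)
  also have "\<dots> \<le> (\<Sum>u\<in>U. prob (E \<inter> I u))"
    using fin ev by (intro finite_measure_subadditive_finite) auto
  also have "\<dots> = (\<Sum>u\<in>U. mass u)" using assms(2) prob_cyl by (intro sum.cong) auto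
  finally show ?thesis .
qed

lemma mass_le_prob:
  assumes "A \<in> sets \<mu>" "w \<in> W k" "E \<inter> I w \<subseteq> A"
  shows "mass w \<le> prob A"
  using finite_measure_mono[OF assms(3,1)] prob_cyl[OF assms(2)] by simp

lemma cyl_subset_ball:
  assumes "w \<in> W k" "x \<in> I w" "\<delta> k < r"
  shows "I w \<subseteq> ball x r"
  using assms cyl_eq[OF assms(1)] by (auto simp: dist_real_def)

lemma prob_ball_pos:
  assumes x: "x \<in> E" and r: "0 < r"
  shows "0 < prob (E \<inter> ball x r)"
proof -
  obtain k where "(1 / 2) ^ k < r" using real_arch_pow_inv[OF r, of "1 / 2"] by auto
  then have k: "\<delta> k < r" using delta_le_half_power[OF data, of k] by simp
  obtain w where w: "w \<in> W k" "x \<in> I w" using E_in_cyl[OF x] .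
  have "mass w \<le> prob (E \<inter> ball x r)"
    using mass_le_prob[OF ball_event w(1)] cyl_subset_ball[OF w k] by blast
  then show ?thesis using mass_pos[OF w(1)] by simp
qed

definition doubling_constant :: "real \<Rightarrow> bool" where
  "doubling_constant D \<longleftrightarrow> 1 \<le> D \<and>
     (\<forall>x\<in>E. \<forall>r>0. prob (E \<inter> ball x (2 * r)) \<le> D * prob (E \<inter> ball x r))"

text \<open>
  Balls have positive measure and the measure is finite, so that the remaining content of the
  doubling condition is an inequality between real numbers.
\<close>

lemma doubling_iff: "doubling_measure_on E \<mu> \<longleftrightarrow> (\<exists>D. doubling_constant D)"
proof -
  have "0 < emeasure \<mu> (E \<inter> ball x (2 * r)) \<and>
      emeasure \<mu> (E \<inter> ball x (2 * r)) \<le> ennreal D * emeasure \<mu> (E \<inter> ball x r) \<and>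
      ennreal D * emeasure \<mu> (E \<inter> ball x r) < \<infinity>
    \<longleftrightarrow> prob (E \<inter> ball x (2 * r)) \<le> D * prob (E \<inter> ball x r)"
    if "1 \<le> D" "x \<in> E" "0 < r" for D x r
    using that prob_ball_pos[of x "2 * r"]
    by (simp add: emeasure_eq_measure ennreal_mult[symmetric] ennreal_mult_less_top
        ennreal_le_iff ennreal_less_zero_iff)
  then show ?thesis
    unfolding doubling_measure_on_def doubling_constant_def using sets_\<mu> by blast
qed


section \<open>Sufficiency of the two conditions\<close>

context
  fixes C :: real and N :: nat
  assumes C: "1 < C" and N: "\<And>k. k \<ge> 1 \<Longrightarrow> n k \<le> N"
    and siblings: "\<And>k i. 1 \<le> k \<Longrightarrow> 1 \<le> i \<Longrightarrow> i < n k \<Longrightarrow>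
      P k i \<le> C * P k (Suc i) \<and> P k (Suc i) \<le> C * P k i"
    and cousins: "\<And>k t. k \<in> Lambda n c \<Longrightarrow> 1 \<le> t \<Longrightarrow> t < mm n c k \<Longrightarrow>
      (\<Prod>j=1..t. P (k + j) 1) \<le> C * (\<Prod>j=1..t. P (k + j) (n (k + j))) \<and>
      (\<Prod>j=1..t. P (k + j) (n (k + j))) \<le> C * (\<Prod>j=1..t. P (k + j) 1)"
begin

lemma siblings_iterated:
  assumes k: "k \<ge> 1" and "1 \<le> i" "i + d \<le> n k"
  shows "P k i \<le> C ^ d * P k (i + d)" and "P k (i + d) \<le> C ^ d * P k i"
proof -
  have "P k i \<le> C ^ d * P k (i + d) \<and> P k (i + d) \<le> C ^ d * P k i"
    using assms(3)
  proof (induction d)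
    case (Suc d)
    have IH: "P k i \<le> C ^ d * P k (i + d)" "P k (i + d) \<le> C ^ d * P k i" using Suc by auto
    have s: "P k (i + d) \<le> C * P k (Suc (i + d))" "P k (Suc (i + d)) \<le> C * P k (i + d)"
      using siblings[of k "i + d"] k assms(2) Suc.prems by auto
    have "P k i \<le> C ^ d * (C * P k (Suc (i + d)))"
      using IH(1) s(1) C by (meson mult_left_mono order_trans zero_le_power less_imp_le zero_less_one)
    moreover have "P k (Suc (i + d)) \<le> C * (C ^ d * P k i)"
      using IH(2) s(2) C by (meson mult_left_mono order_trans less_imp_le zero_less_one)
    ultimately show ?case by (simp add: mult_ac)
  qed simp
  then show "P k i \<le> C ^ d * P k (i + d)" and "P k (i + d) \<le> C ^ d * P k i" by auto
qed

text \<open>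
  Each of the at most \<open>N\<close> weights of a level is at most \<open>C ^ N\<close> times the weight in question, and
  they add up to \<open>1\<close>.
\<close>

lemma P_lower_bound:
  assumes k: "k \<ge> 1" and i: "i \<in> {1..n k}"
  shows "1 / (real N * C ^ N) \<le> P k i"
proof -
  have le: "P k j \<le> C ^ N * P k i" if j: "j \<in> {1..n k}" for j
  proof -
    have pow: "C ^ d * P k i \<le> C ^ N * P k i" if "d \<le> n k" for d
      using that N[OF k] C P_pos[OF k i] by (intro mult_right_mono power_increasing) auto
    show ?thesis
    proof (cases "i \<le> j")
      case True
      then have "P k j \<le> C ^ (j - i) * P k i"
        using siblings_iterated(2)[OF k, of i "j - i"] i j by simp
      also have "\<dots> \<le> C ^ N * P k i" using j by (intro pow) auto
      finally show ?thesis .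
    next
      case False
      then have "P k j \<le> C ^ (i - j) * P k i"
        using siblings_iterated(1)[OF k, of j "i - j"] i j by simp
      also have "\<dots> \<le> C ^ N * P k i" using i by (intro pow) auto
      finally show ?thesis .
    qed
  qed
  have "1 = (\<Sum>j=1..n k. P k j)" using P_sum[OF k] by simp
  also have "\<dots> \<le> (\<Sum>j=1..n k. C ^ N * P k i)" by (intro sum_mono le)
  also have "\<dots> = real (n k) * (C ^ N * P k i)" by simp
  also have "\<dots> \<le> real N * (C ^ N * P k i)"
    using N[OF k] C P_pos[OF k i] by (intro mult_right_mono) auto
  finally have "1 \<le> P k i * (real N * C ^ N)" by (simp add: mult_ac)
  moreover have "0 < real N * C ^ N" using C N[OF k] branching[OF k] by auto
  ultimately show ?thesis by (simp add: pos_divide_le_eq)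
qed

text \<open>
  If the two cylinders are children of one parent, this is (a). Otherwise they are the cylinders
  on the two sides of a gap of level \<open>Suc k\<close>, \<open>t\<close> levels further down, and \<open>\<epsilon> (Suc k) < \<delta> K\<close> puts \<open>t\<close>
  into the range of (b).
\<close>

lemma adjacent_mass:
  assumes uv: "u \<in> W K" "v \<in> W K" "u \<noteq> v" and xy: "x \<in> I u" "y \<in> I v" "x < y" "y < x + \<delta> K"
  shows "mass u \<le> C\<^sup>2 * mass v" and "mass v \<le> C\<^sup>2 * mass u"
proof -
  obtain k t w i where kt: "K = Suc k + t" and w: "w \<in> W k" and i: "1 \<le> i" "i < n (Suc k)"
    and u: "u = (w @ [i]) @ rights n (Suc k) t" and v: "v = (w @ [Suc i]) @ lefts t"
    using close_cylinders_adjacent[OF uv xy] by blast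
  have wi: "w @ [i] \<in> W (Suc k)" "w @ [Suc i] \<in> W (Suc k)" using snoc_in_words[OF w] i by auto
  define F where "F = (\<Prod>j=1..t. P (Suc k + j) 1)"
  define G where "G = (\<Prod>j=1..t. P (Suc k + j) (n (Suc k + j)))"
  have FG: "F \<le> C * G" "G \<le> C * F"
  proof -
    have "F \<le> C * G \<and> G \<le> C * F"
    proof (cases "t = 0")
      case True
      then show ?thesis using C by (simp add: F_def G_def)
    next
      case False
      have "lft v = rgt u + \<epsilon> (Suc k)"
        using lft_snoc_Suc[OF w] i append_lefts(2)[OF wi(2)] append_rights(2)[OF wi(1)] u v by auto
      then have gap: "\<epsilon> (Suc k) < \<delta> K"
        using cyl_eq(1)[OF uv(1)] cyl_eq(1)[OF uv(2)] xy by auto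
      then have L: "Suc k \<in> Lambda n c"
        using delta_antimono[OF data, of "Suc k" K] kt by (auto simp: Lambda_def)
      have "t < mm n c (Suc k)"
      proof (rule ccontr)
        assume "\<not> ?thesis"
        then have "\<delta> K \<le> \<delta> (Suc k + mm n c (Suc k))"
          using kt by (intro delta_antimono[OF data]) simp
        then show False using mm_props(2)[OF data L] gap by simp
      qed
      then show ?thesis using cousins[OF L, of t] False by (simp add: F_def G_def)
    qed
    then show "F \<le> C * G" "G \<le> C * F" by auto
  qed
  have pos: "0 < mass w" "0 < P (Suc k) i" "0 < P (Suc k) (Suc i)" "0 < F" "0 < G"
    unfolding F_def G_def using mass_pos[OF w] P_pos[of "Suc k"] i P_first_pos P_last_pos
    by (auto intro!: prod_pos)
  have mu: "mass u = mass w * (P (Suc k) i * G)" and mv: "mass v = mass w * (P (Suc k) (Suc i) * F)"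
    using mass_append_rights[OF wi(1), of t] mass_append_lefts[OF wi(2), of t] mass_snoc[OF w]
    by (auto simp: u v F_def G_def)
  have s: "P (Suc k) i \<le> C * P (Suc k) (Suc i)" "P (Suc k) (Suc i) \<le> C * P (Suc k) i"
    using siblings[of "Suc k" i] i by auto
  have "P (Suc k) i * G \<le> (C * P (Suc k) (Suc i)) * (C * F)"
    using s FG pos C by (intro mult_mono) auto
  then show "mass u \<le> C\<^sup>2 * mass v"
    using pos(1) by (simp add: mu mv power2_eq_square mult_ac)
  have "P (Suc k) (Suc i) * F \<le> (C * P (Suc k) i) * (C * G)"
    using s FG pos C by (intro mult_mono) auto
  then show "mass v \<le> C\<^sup>2 * mass u"
    using pos(1) by (simp add: mu mv power2_eq_square mult_ac)
qed

lemma sufficiency: "\<exists>D. doubling_constant D"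
proof -
  define \<eta> where "\<eta> = 1 / (real N * C ^ N)"
  define D where "D = 3 * C\<^sup>2 / \<eta>\<^sup>2"
  have N1: "1 \<le> real N" using N[of 1] branching[of 1] by simp
  have C2: "1 \<le> C\<^sup>2" using C by (intro one_le_power) auto
  have \<eta>: "0 < \<eta>" using N1 C by (simp add: \<eta>_def)
  have \<eta>_le: "\<eta> \<le> P (Suc k) i" if "i \<in> {1..n (Suc k)}" for k i
    using P_lower_bound[of "Suc k" i] that by (simp add: \<eta>_def)
  have "\<eta> \<le> 1" using \<eta>_le[of 1 0] P_le_1[of 1 1] branching[of 1] by auto
  then have \<eta>2: "\<eta>\<^sup>2 \<le> \<eta>" "\<eta>\<^sup>2 \<le> 1" "0 < \<eta>\<^sup>2"
    using \<eta> by (auto simp: power2_eq_square mult_le_one intro: mult_left_le)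
  have "1 \<le> D" using \<eta>2 C2 by (simp add: D_def pos_le_divide_eq)
  moreover have "prob (E \<inter> ball x (2 * r)) \<le> D * prob (E \<inter> ball x r)"
    if x: "x \<in> E" and r: "0 < r" for x r
  proof -
    have mass_child: "\<eta> * mass w \<le> mass (w @ [i])"
      if "w \<in> W k" "i \<in> {1..n (Suc k)}" for w k i
      using \<eta>_le[OF that(2)] mass_pos[OF that(1)] mass_snoc[OF that(1)] by (simp add: mult.commute)
    show ?thesis
    proof (cases "2 * r \<le> 1")
      case False
      have "x \<in> I []" using x E_subset_unit by auto
      then obtain i where i: "i \<in> {1..n (Suc 0)}" "x \<in> I ([] @ [i])"
        using E_in_child[OF x, of "[]" 0] by (metis singletonI words_0)
      have w: "[] @ [i] \<in> W (Suc 0)" using snoc_in_words[of "[]" n 0 i] i by simp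
      have "\<delta> (Suc 0) < r" using delta_Suc_le[OF data, of 0] False by simp
      then have "mass ([] @ [i]) \<le> prob (E \<inter> ball x r)"
        using mass_le_prob[OF ball_event w] cyl_subset_ball[OF w i(2)] by blast
      then have "\<eta>\<^sup>2 \<le> prob (E \<inter> ball x r)"
        using mass_child[of "[]" 0 i] i \<eta>2 by (simp add: mass_def)
      then have "1 \<le> prob (E \<inter> ball x r) / \<eta>\<^sup>2" using \<eta>2 by (simp add: pos_le_divide_eq)
      moreover have "1 * (prob (E \<inter> ball x r) / \<eta>\<^sup>2) \<le> 3 * C\<^sup>2 * (prob (E \<inter> ball x r) / \<eta>\<^sup>2)"
        using C2 by (intro mult_right_mono) auto
      ultimately have "1 \<le> D * prob (E \<inter> ball x r)" by (simp add: D_def)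
      then show ?thesis using prob_le_1 order_trans by blast
    next
      case True
      obtain k0 where "(1 / 2) ^ k0 < 2 * r" using real_arch_pow_inv[of "2 * r" "1 / 2"] r by auto
      then have ex: "\<delta> k0 < 2 * r" using delta_le_half_power[OF data, of k0] by simp
      \<comment> \<open>\<open>K = m - 1\<close> is the deepest level whose cylinders are at least as long as \<open>2 * r\<close>.\<close>
      define m where "m = (LEAST k. \<delta> k < 2 * r)"
      have m: "\<delta> m < 2 * r" unfolding m_def using ex by (rule LeastI)
      then have "m \<noteq> 0" using True by (auto intro: ccontr)
      then obtain K where K: "m = Suc K" using not0_implies_Suc by blast
      have rK: "2 * r \<le> \<delta> K"
        using not_less_Least[of K "\<lambda>k. \<delta> k < 2 * r"] K by (simp add: m_def)
      obtain u where u: "u \<in> W K" "x \<in> I u" using E_in_cyl[OF x] .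
      obtain i where i: "i \<in> {1..n (Suc K)}" "x \<in> I (u @ [i])" using E_in_child[OF x u] .
      have ui: "u @ [i] \<in> W (Suc K)" using snoc_in_words[OF u(1) i(1)] .
      obtain j where j: "j \<in> {1..n (Suc (Suc K))}" "x \<in> I ((u @ [i]) @ [j])"
        using E_in_child[OF x ui i(2)] .
      have uij: "(u @ [i]) @ [j] \<in> W (Suc (Suc K))" using snoc_in_words[OF ui j(1)] .
      \<comment> \<open>Lengths at least halve at each level, and \<open>\<delta> (Suc K) < 2 * r\<close>.\<close>
      have "\<delta> (Suc (Suc K)) < r" using delta_Suc_le[OF data, of "Suc K"] m K by simp
      then have "mass ((u @ [i]) @ [j]) \<le> prob (E \<inter> ball x r)"
        using mass_le_prob[OF ball_event uij] cyl_subset_ball[OF uij j(2)] by blast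
      moreover have "\<eta> * (\<eta> * mass u) \<le> \<eta> * mass (u @ [i])"
        using mass_child[OF u(1) i(1)] \<eta> by (intro mult_left_mono) auto
      ultimately have lower: "\<eta>\<^sup>2 * mass u \<le> prob (E \<inter> ball x r)"
        using mass_child[OF ui j(1)] by (simp add: power2_eq_square mult.assoc)
      define S where "S = {v \<in> W K. I v \<inter> ball x (2 * r) \<noteq> {}}"
      have "E \<inter> ball x (2 * r) \<subseteq> (\<Union>v\<in>S. I v)"
        unfolding S_def by (auto elim!: E_in_cyl[of _ K])
      then have "prob (E \<inter> ball x (2 * r)) \<le> (\<Sum>v\<in>S. mass v)"
        by (intro prob_le_sum_mass[of _ _ K] ball_event) (auto simp: S_def)
      also have "\<dots> \<le> (\<Sum>v\<in>S. C\<^sup>2 * mass u)"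
      proof (rule sum_mono)
        fix v assume "v \<in> S"
        then obtain y where y: "v \<in> W K" "y \<in> I v" "\<bar>x - y\<bar> < 2 * r"
          by (auto simp: S_def dist_real_def)
        consider "v = u" | "v \<noteq> u" "x < y" | "v \<noteq> u" "y < x"
          using cyl_disjoint[OF data u(1) y(1)] u(2) y(2) by (metis disjoint_iff linorder_neqE)
        then show "mass v \<le> C\<^sup>2 * mass u"
        proof cases
          case 1
          have "1 * mass u \<le> C\<^sup>2 * mass u" using C2 mass_pos[OF u(1)] by (intro mult_right_mono) auto
          then show ?thesis using 1 by simp
        next
          case 2
          then show ?thesis using adjacent_mass(2)[OF u(1) y(1) _ u(2) y(2)] y rK by auto
        next
          case 3
          then show ?thesis using adjacent_mass(1)[OF y(1) u(1) _ y(2) u(2)] y rK by auto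
        qed
      qed
      also have "\<dots> = real (card S) * (C\<^sup>2 * mass u)" by simp
      also have "\<dots> \<le> 3 * (C\<^sup>2 * mass u)"
      proof (rule mult_right_mono)
        show "real (card S) \<le> 3"
          using ball_meets_at_most_three[OF u rK] by (simp add: S_def)
        show "0 \<le> C\<^sup>2 * mass u" using mass_pos[OF u(1)] by simp
      qed
      also have "\<dots> = D * (\<eta>\<^sup>2 * mass u)" using \<eta>2 by (simp add: D_def)
      also have "\<dots> \<le> D * prob (E \<inter> ball x r)"
        using lower \<open>1 \<le> D\<close> by (intro mult_left_mono) auto
      finally show ?thesis .
    qed
  qed
  ultimately show ?thesis unfolding doubling_constant_def by blast
qed

end

end


section \<open>Necessity of the two conditions\<close>

text \<open>
  The sequence \<open>q\<close> grows by a factor of at most \<open>x = B * G / F\<close> in each step. If \<open>x\<close> were less than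
  \<open>\<eta> \<le> 1\<close>, then \<open>q\<close> would fall below \<open>\<eta>\<close> after the first step and stay there.
\<close>

lemma ratio_lower_bound_of_chain:
  fixes q :: "nat \<Rightarrow> real" and F G B \<eta> :: real
  assumes pos: "0 < F" "0 \<le> G" "0 \<le> B" "0 < \<eta>"
    and m: "2 \<le> m" and q: "0 < q 1" "q 1 \<le> 1" "\<eta> \<le> q m" "\<eta> \<le> 1"
    and step: "\<And>i. 1 \<le> i \<Longrightarrow> i < m \<Longrightarrow> q (Suc i) * F \<le> B * (q i * G)"
  shows "\<eta> * F \<le> B * G"
proof (rule ccontr)
  define x where "x = B * G / F"
  assume "\<not> ?thesis"
  then have x: "x < \<eta>" "0 \<le> x" using pos by (auto simp: x_def pos_divide_less_eq)
  have step': "q (Suc i) \<le> x * q i" if "1 \<le> i" "i < m" for i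
    using step[OF that] pos by (simp add: x_def field_simps)
  have "q (Suc d) \<le> x ^ d * q 1" if "Suc d \<le> m" for d
    using that
  proof (induction d)
    case (Suc d)
    have "q (Suc (Suc d)) \<le> x * q (Suc d)" using step'[of "Suc d"] Suc.prems by simp
    also have "\<dots> \<le> x * (x ^ d * q 1)" using Suc x by (intro mult_left_mono) auto
    finally show ?case by simp
  qed simp
  from this[of "m - 1"] have "q m \<le> x ^ (m - 1) * q 1" using m by simp
  also have "\<dots> \<le> x ^ (m - 1)" using q x by (intro mult_left_le) auto
  also have "\<dots> \<le> x ^ 1" using x q m by (intro power_decreasing) auto
  finally show False using x q by simp
qed

locale doubling_cantor_mass = cantor_mass +
  fixes D :: real and N :: nat
  assumes doubling: "doubling_constant D" and N: "\<And>k. k \<ge> 1 \<Longrightarrow> n k \<le> N"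
begin

lemma D_ge_1: "1 \<le> D"
  using doubling by (simp add: doubling_constant_def)

lemma doubling_iterated:
  assumes "x \<in> E" "0 < r"
  shows "prob (E \<inter> ball x (2 ^ a * r)) \<le> D ^ a * prob (E \<inter> ball x r)"
proof (induction a)
  case (Suc a)
  have "prob (E \<inter> ball x (2 * (2 ^ a * r))) \<le> D * prob (E \<inter> ball x (2 ^ a * r))"
    using doubling assms by (simp add: doubling_constant_def)
  also have "\<dots> \<le> D * (D ^ a * prob (E \<inter> ball x r))"
    using Suc D_ge_1 by (intro mult_left_mono) auto
  finally show ?case by (simp add: mult_ac)
qed simp

text \<open>
  All lower bounds on masses come from this comparison: the ball of radius \<open>r\<close> sees only the
  cylinders in \<open>U\<close>, whereas \<open>a\<close> doublings reach the whole cylinder of \<open>v\<close>.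
\<close>

lemma mass_le_of_balls:
  assumes "x \<in> E" "0 < r" "U \<subseteq> W k" "E \<inter> ball x r \<subseteq> (\<Union>u\<in>U. I u)"
    and "v \<in> W l" "I v \<subseteq> ball x (2 ^ a * r)"
  shows "mass v \<le> D ^ a * (\<Sum>u\<in>U. mass u)"
proof -
  have "mass v \<le> prob (E \<inter> ball x (2 ^ a * r))"
    using assms(6) by (intro mass_le_prob[OF ball_event assms(5)]) blast
  also have "\<dots> \<le> D ^ a * prob (E \<inter> ball x r)" by (rule doubling_iterated[OF assms(1,2)])
  also have "\<dots> \<le> D ^ a * (\<Sum>u\<in>U. mass u)"
    using prob_le_sum_mass[OF ball_event assms(3,4)] D_ge_1 by (intro mult_left_mono) auto
  finally show ?thesis .
qed

lemma \<delta>_lt_pow: "\<delta> k < 2 ^ N * (\<delta> (Suc k) + \<epsilon> (Suc k))"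
proof -
  have "\<delta> k < real (n (Suc k)) * (\<delta> (Suc k) + \<epsilon> (Suc k))"
    using \<delta>_split[of k] \<epsilon>_pos[of "Suc k"] by (simp add: algebra_simps)
  also have "\<dots> \<le> real N * (\<delta> (Suc k) + \<epsilon> (Suc k))"
    using N[of "Suc k"] \<epsilon>_pos[of "Suc k"] \<delta>_pos[of "Suc k"] by (intro mult_right_mono) auto
  also have "\<dots> \<le> 2 ^ N * (\<delta> (Suc k) + \<epsilon> (Suc k))"
    using \<epsilon>_pos[of "Suc k"] \<delta>_pos[of "Suc k"] of_nat_less_two_power[of N]
    by (intro mult_right_mono) auto
  finally show ?thesis .
qed

lemma weight_from_balls:
  assumes w: "w \<in> W k" and i: "i \<in> {1..n (Suc k)}"
    and x: "x \<in> E" "x \<in> I w" and r: "0 < r" "\<delta> k < 2 ^ a * r"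
    and "E \<inter> ball x r \<subseteq> I (w @ [i])"
  shows "1 \<le> D ^ a * P (Suc k) i"
proof -
  have "mass w \<le> D ^ a * (\<Sum>u\<in>{w @ [i]}. mass u)"
    using snoc_in_words[OF w i] assms(7) cyl_subset_ball[OF w x(2) r(2)]
    by (intro mass_le_of_balls[OF x(1) r(1) _ _ w]) auto
  also have "\<dots> = mass w * (D ^ a * P (Suc k) i)" using mass_snoc[OF w] by simp
  finally show ?thesis using mass_pos[OF w] by simp
qed

text \<open>
  The cylinder of the word \<open>1 \<dots> 1\<close> starts at \<open>0\<close> and thus has no neighbour on the left. A ball around
  \<open>0\<close> that ends at the second child sees only the first one, no matter how short the children are
  compared with the gap; and because the branching is bounded, \<open>N\<close> doublings reach the whole parent.
\<close>

lemma P_first_ge: "1 \<le> D ^ N * P (Suc k) 1"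
proof -
  have "[] \<in> W 0" by simp
  from append_lefts[OF this, of k] obtain w where w: "w \<in> W k" "lft w = 0"
    by (auto simp: lft_def)
  have "E \<inter> ball (lft w) (\<delta> (Suc k) + \<epsilon> (Suc k)) \<subseteq> I (w @ [1])"
  proof
    fix y assume "y \<in> E \<inter> ball (lft w) (\<delta> (Suc k) + \<epsilon> (Suc k))"
    then show "y \<in> I (w @ [1])"
      using near_first_child[OF _ w(1), of y] E_subset_unit w(2) by (auto simp: dist_real_def)
  qed
  then show ?thesis
    using branching[of "Suc k"] lft_in_E[OF w(1)] cyl_eq[OF w(1)] \<delta>_pos[of k] \<delta>_pos[of "Suc k"]
      \<epsilon>_pos[of "Suc k"] \<delta>_lt_pow[of k]
    by (intro weight_from_balls[OF w(1), of 1 "lft w" "\<delta> (Suc k) + \<epsilon> (Suc k)" N]) auto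
qed

lemma P_last_ge: "1 \<le> D ^ N * P (Suc k) (n (Suc k))"
proof -
  have "[] \<in> W 0" by simp
  from append_rights[OF this, of k] obtain w where w: "w \<in> W k" "rgt w = 1"
    by (auto simp: rgt_def)
  have "E \<inter> ball (rgt w) (\<delta> (Suc k) + \<epsilon> (Suc k)) \<subseteq> I (w @ [n (Suc k)])"
  proof
    fix y assume "y \<in> E \<inter> ball (rgt w) (\<delta> (Suc k) + \<epsilon> (Suc k))"
    then show "y \<in> I (w @ [n (Suc k)])"
      using near_last_child[OF _ w(1), of y] E_subset_unit w(2) by (auto simp: dist_real_def)
  qed
  then show ?thesis
    using branching[of "Suc k"] rgt_in_E[OF w(1)] cyl_eq[OF w(1)] \<delta>_pos[of k] \<delta>_pos[of "Suc k"]
      \<epsilon>_pos[of "Suc k"] \<delta>_lt_pow[of k]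
    by (intro weight_from_balls[OF w(1), of "n (Suc k)" "rgt w" "\<delta> (Suc k) + \<epsilon> (Suc k)" N]) auto
qed

text \<open>
  Inner children have gaps of level \<open>Suc k\<close> on both sides. When these are no shorter than the
  children, a ball of radius \<open>\<epsilon> (Suc k)\<close> isolates one child and is of the size of the parent.
\<close>

lemma P_ge_if_wide_gap:
  assumes wide: "\<delta> (Suc k) \<le> \<epsilon> (Suc k)" and i: "i \<in> {1..n (Suc k)}"
  shows "1 \<le> D ^ (N + 1) * P (Suc k) i"
proof (cases "i = 1 \<or> i = n (Suc k)")
  case True
  then have "1 \<le> D ^ N * P (Suc k) i" using P_first_ge P_last_ge by auto
  also have "\<dots> \<le> D ^ (N + 1) * P (Suc k) i"
    using D_ge_1 P_pos[of "Suc k" i] i by (intro mult_right_mono power_increasing) auto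
  finally show ?thesis .
next
  case False
  have "[] \<in> W 0" by simp
  from append_lefts(1)[OF this, of k] obtain w where w: "w \<in> W k" by auto
  have i': "1 \<le> i - 1" "i - 1 < n (Suc k)" "Suc (i - 1) = i" "i - 1 \<in> {1..n (Suc k)}"
    "1 \<le> i" "i < n (Suc k)" using i False by auto
  have wi: "w @ [i] \<in> W (Suc k)" using snoc_in_words[OF w i] .
  have left: "lft (w @ [i]) = rgt (w @ [i - 1]) + \<epsilon> (Suc k)"
    using lft_snoc_Suc[OF w i'(4)] i'(3) by simp
  have right: "lft (w @ [Suc i]) = rgt (w @ [i]) + \<epsilon> (Suc k)"
    using lft_snoc_Suc[OF w i] .
  have "E \<inter> ball (lft (w @ [i])) (\<epsilon> (Suc k)) \<subseteq> I (w @ [i])"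
  proof
    fix y assume "y \<in> E \<inter> ball (lft (w @ [i])) (\<epsilon> (Suc k))"
    then have y: "y \<in> E" "\<bar>lft (w @ [i]) - y\<bar> < \<epsilon> (Suc k)" by (auto simp: dist_real_def)
    have "lft (w @ [i]) \<le> y"
      using gap_avoided[OF y(1) w i'(1,2)] left y(2) i'(3) by auto
    moreover have "y \<le> rgt (w @ [i])"
      using gap_avoided[OF y(1) w i'(5,6)] right y(2) \<delta>_pos[of "Suc k"] cyl_eq(2)[OF wi]
      by fastforce
    ultimately show "y \<in> I (w @ [i])" using cyl_eq(1)[OF wi] by simp
  qed
  moreover have "\<delta> k < 2 ^ (N + 1) * \<epsilon> (Suc k)"
  proof -
    have "\<delta> k < 2 ^ N * (\<delta> (Suc k) + \<epsilon> (Suc k))" by (rule \<delta>_lt_pow)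
    also have "\<dots> \<le> 2 ^ N * (2 * \<epsilon> (Suc k))"
      using wide by (intro mult_left_mono) auto
    finally show ?thesis by (simp add: mult_ac)
  qed
  moreover have "lft (w @ [i]) \<in> I w"
    using cyl_child_subset[OF data w i] cyl_eq[OF wi] \<delta>_pos[of "Suc k"] by auto
  moreover have "0 < \<epsilon> (Suc k)" by (simp add: \<epsilon>_pos)
  ultimately show ?thesis
    using weight_from_balls[OF w i lft_in_E[OF wi], where r = "\<epsilon> (Suc k)" and a = "N + 1"]
    by blast
qed

text \<open>
  The value \<open>t = mm n c (Suc k) - 1\<close> is the one at which the gap length lies between the lengths of
  two successive levels: the ball of radius \<open>\<epsilon> (Suc k)\<close> at one bank of the gap lies in the cylinder
  of level \<open>Suc k + t\<close> there, and two doublings reach the cylinder one level further down on the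
  opposite bank. Descending that one level costs a first or last weight, hence a factor \<open>D ^ N\<close>.
\<close>

lemma across_gap:
  assumes L: "Suc k \<in> Lambda n c" and i: "1 \<le> i" "i < n (Suc k)"
  defines "t \<equiv> mm n c (Suc k) - 1"
  defines "F \<equiv> (\<Prod>j=1..t. P (Suc k + j) 1)" and "G \<equiv> (\<Prod>j=1..t. P (Suc k + j) (n (Suc k + j)))"
  shows "P (Suc k) (Suc i) * F \<le> D ^ (N + 2) * (P (Suc k) i * G)"
    and "P (Suc k) i * G \<le> D ^ (N + 2) * (P (Suc k) (Suc i) * F)"
proof -
  have "[] \<in> W 0" by simp
  from append_lefts(1)[OF this, of k] obtain w where w: "w \<in> W k" by auto
  have ii: "i \<in> {1..n (Suc k)}" "Suc i \<in> {1..n (Suc k)}" using i by auto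
  define a where "a = w @ [i]"
  define b where "b = w @ [Suc i]"
  have a: "a \<in> W (Suc k)" and b: "b \<in> W (Suc k)"
    using snoc_in_words[OF w] ii by (auto simp: a_def b_def)
  have ab: "lft b = rgt a + \<epsilon> (Suc k)" using lft_snoc_Suc[OF w ii(1)] by (simp add: a_def b_def)
  have t: "mm n c (Suc k) = Suc t" using mm_props(1)[OF data L] by (simp add: t_def)
  have scale: "\<delta> (Suc k + Suc t) \<le> \<epsilon> (Suc k)" "\<epsilon> (Suc k) < \<delta> (Suc k + t)"
    using mm_props(2,3)[OF data L] t by auto
  have gap: "lft b \<le> y" if "y \<in> E" "rgt a < y" for y
    using gap_avoided[OF that(1) w i] that(2) by (simp add: a_def b_def)
  note ar = append_rights[OF a, of t] and bl = append_lefts[OF b, of t]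
  note ar' = append_rights[OF a, of "Suc t"] and bl' = append_lefts[OF b, of "Suc t"]
  have FG: "0 < F" "0 < G"
    unfolding F_def G_def using P_first_pos P_last_pos by (auto intro!: prod_pos)
  have pos: "0 < mass w" "0 < P (Suc k) i" "0 < P (Suc k) (Suc i)" "0 < D ^ N"
    using mass_pos[OF w] P_pos[of "Suc k"] ii D_ge_1 by auto
  have ma: "mass (a @ rights n (Suc k) t) = mass w * (P (Suc k) i * G)"
    and mb: "mass (b @ lefts t) = mass w * (P (Suc k) (Suc i) * F)"
    using mass_append_rights[OF a, of t] mass_append_lefts[OF b, of t] mass_snoc[OF w]
    by (auto simp: a_def b_def F_def G_def)
  have ma': "mass (a @ rights n (Suc k) (Suc t))
      = mass w * (P (Suc k) i * G) * P (Suc (Suc k + t)) (n (Suc (Suc k + t)))"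
    using mass_append_rights[OF a, of "Suc t"] mass_snoc[OF w] by (simp add: a_def G_def)
  have mb': "mass (b @ lefts (Suc t)) = mass w * (P (Suc k) (Suc i) * F) * P (Suc (Suc k + t)) 1"
    using mass_append_lefts[OF b, of "Suc t"] mass_snoc[OF w] by (simp add: b_def F_def)
  have "E \<inter> ball (rgt a) (\<epsilon> (Suc k)) \<subseteq> I (a @ rights n (Suc k) t)"
  proof
    fix y assume "y \<in> E \<inter> ball (rgt a) (\<epsilon> (Suc k))"
    then have y: "y \<in> E" "rgt a - \<epsilon> (Suc k) < y" "y < rgt a + \<epsilon> (Suc k)"
      by (auto simp: dist_real_def)
    have "y \<le> rgt a" using gap[OF y(1)] ab y(3) by linarith
    then show "y \<in> I (a @ rights n (Suc k) t)"
      using y(2) cyl_eq[OF ar(1)] ar(2) scale(2) by simp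
  qed
  moreover have "I (b @ lefts (Suc t)) \<subseteq> ball (rgt a) (2\<^sup>2 * \<epsilon> (Suc k))"
    using cyl_eq[OF bl'(1)] bl'(2) ab scale(1) \<epsilon>_pos[of "Suc k"] \<delta>_pos[of "Suc k + Suc t"]
    by (auto simp: dist_real_def)
  ultimately have "mass (b @ lefts (Suc t)) \<le> D\<^sup>2 * (\<Sum>u\<in>{a @ rights n (Suc k) t}. mass u)"
    using ar(1) \<epsilon>_pos[of "Suc k"]
    by (intro mass_le_of_balls[OF rgt_in_E[OF a] _ _ _ bl'(1)]) auto
  then have "mass (b @ lefts (Suc t)) \<le> D\<^sup>2 * mass (a @ rights n (Suc k) t)" by simp
  then have "P (Suc k) (Suc i) * F * P (Suc (Suc k + t)) 1 \<le> D\<^sup>2 * (P (Suc k) i * G)"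
    using pos(1) unfolding mb' ma by (simp add: mult_ac)
  then have "D ^ N * (P (Suc k) (Suc i) * F * P (Suc (Suc k + t)) 1)
      \<le> D ^ N * (D\<^sup>2 * (P (Suc k) i * G))"
    using pos by (intro mult_left_mono) auto
  moreover have "P (Suc k) (Suc i) * F * 1
      \<le> P (Suc k) (Suc i) * F * (D ^ N * P (Suc (Suc k + t)) 1)"
    using P_first_ge pos FG by (intro mult_left_mono) auto
  ultimately show "P (Suc k) (Suc i) * F \<le> D ^ (N + 2) * (P (Suc k) i * G)"
    by (simp add: power_add power2_eq_square mult_ac)
  have "E \<inter> ball (lft b) (\<epsilon> (Suc k)) \<subseteq> I (b @ lefts t)"
  proof
    fix y assume "y \<in> E \<inter> ball (lft b) (\<epsilon> (Suc k))"
    then have y: "y \<in> E" "lft b - \<epsilon> (Suc k) < y" "y < lft b + \<epsilon> (Suc k)"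
      by (auto simp: dist_real_def)
    have "lft b \<le> y" using gap[OF y(1)] ab y(2) by linarith
    then show "y \<in> I (b @ lefts t)"
      using y(3) cyl_eq[OF bl(1)] bl(2) scale(2) by simp
  qed
  moreover have "I (a @ rights n (Suc k) (Suc t)) \<subseteq> ball (lft b) (2\<^sup>2 * \<epsilon> (Suc k))"
    using cyl_eq[OF ar'(1)] ar'(2) ab scale(1) \<epsilon>_pos[of "Suc k"] \<delta>_pos[of "Suc k + Suc t"]
    by (auto simp: dist_real_def)
  ultimately have "mass (a @ rights n (Suc k) (Suc t)) \<le> D\<^sup>2 * (\<Sum>u\<in>{b @ lefts t}. mass u)"
    using bl(1) \<epsilon>_pos[of "Suc k"]
    by (intro mass_le_of_balls[OF lft_in_E[OF b] _ _ _ ar'(1)]) auto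
  then have "mass (a @ rights n (Suc k) (Suc t)) \<le> D\<^sup>2 * mass (b @ lefts t)" by simp
  then have "P (Suc k) i * G * P (Suc (Suc k + t)) (n (Suc (Suc k + t)))
      \<le> D\<^sup>2 * (P (Suc k) (Suc i) * F)"
    using pos(1) unfolding ma' mb by (simp add: mult_ac)
  then have "D ^ N * (P (Suc k) i * G * P (Suc (Suc k + t)) (n (Suc (Suc k + t))))
      \<le> D ^ N * (D\<^sup>2 * (P (Suc k) (Suc i) * F))"
    using pos by (intro mult_left_mono) auto
  moreover have "P (Suc k) i * G * 1
      \<le> P (Suc k) i * G * (D ^ N * P (Suc (Suc k + t)) (n (Suc (Suc k + t))))"
    using P_last_ge pos FG by (intro mult_left_mono) auto
  ultimately show "P (Suc k) i * G \<le> D ^ (N + 2) * (P (Suc k) (Suc i) * F)"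
    by (simp add: power_add power2_eq_square mult_ac)
qed

text \<open>
  In the presence of a short gap, \<open>across_gap\<close> makes \<open>F / G\<close>, up to constants, the ratio of \<open>P k i\<close> and
  \<open>P k (Suc i)\<close> for all \<open>i\<close> simultaneously. As the first and the last weight are bounded below,
  the chain from one to the other bounds \<open>F / G\<close> from both sides.
\<close>

lemma siblings_comparable:
  assumes k: "k \<ge> 1" and i: "1 \<le> i" "i < n k"
  shows "P k i \<le> D ^ (3 * N + 4) * P k (Suc i)" and "P k (Suc i) \<le> D ^ (3 * N + 4) * P k i"
proof -
  obtain k' where k': "k = Suc k'" using k by (cases k) auto
  have ii: "i \<in> {1..n k}" "Suc i \<in> {1..n k}" using i by auto
  have pos: "0 < P k i" "0 < P k (Suc i)" using P_pos[OF k] ii by auto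
  have "P k i \<le> D ^ (3 * N + 4) * P k (Suc i) \<and> P k (Suc i) \<le> D ^ (3 * N + 4) * P k i"
  proof (cases "k \<in> Lambda n c")
    case False
    then have "\<delta> (Suc k') \<le> \<epsilon> (Suc k')" using k' by (auto simp: Lambda_def)
    note ge = P_ge_if_wide_gap[OF this]
    have D: "D ^ (N + 1) \<le> D ^ (3 * N + 4)" using D_ge_1 by (intro power_increasing) auto
    have "1 \<le> D ^ (N + 1) * P k i" "1 \<le> D ^ (N + 1) * P k (Suc i)"
      using ge ii unfolding k' by blast+
    then have "1 \<le> D ^ (3 * N + 4) * P k i" "1 \<le> D ^ (3 * N + 4) * P k (Suc i)"
      using mult_right_mono[OF D, of "P k i"] mult_right_mono[OF D, of "P k (Suc i)"] pos
      by linarith+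
    then show ?thesis using P_le_1[OF k ii(1)] P_le_1[OF k ii(2)] by linarith
  next
    case True
    define t where "t = mm n c k - 1"
    define F where "F = (\<Prod>j=1..t. P (k + j) 1)"
    define G where "G = (\<Prod>j=1..t. P (k + j) (n (k + j)))"
    have FG: "0 < F" "0 < G"
      unfolding F_def G_def k' using P_first_pos P_last_pos by (auto intro!: prod_pos)
    have step: "P k (Suc j) * F \<le> D ^ (N + 2) * (P k j * G)"
      "P k j * G \<le> D ^ (N + 2) * (P k (Suc j) * F)" if "1 \<le> j" "j < n k" for j
      using across_gap[of k' j] True that by (auto simp: k' F_def G_def t_def)
    have D: "0 < D ^ N" "1 \<le> D ^ N" using D_ge_1 by auto
    have ends: "1 / D ^ N \<le> P k 1" "1 / D ^ N \<le> P k (n k)"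
      using P_first_ge[of k'] P_last_ge[of k'] D by (auto simp: k' pos_divide_le_eq mult.commute)
    have nk: "1 \<in> {1..n k}" "n k \<in> {1..n k}" "2 \<le> n k" using branching[OF k] by auto
    have "1 / D ^ N * F \<le> D ^ (N + 2) * G"
      using ends D FG nk P_pos[OF k nk(1)] P_le_1[OF k nk(1)] step(1) D_ge_1
      by (intro ratio_lower_bound_of_chain[of F G _ _ "n k" "P k"]) auto
    then have "F \<le> D ^ N * D ^ (N + 2) * G"
      using D(1) by (simp add: pos_divide_le_eq mult_ac)
    then have F_le: "F \<le> D ^ (2 * N + 2) * G"
      unfolding power_add[symmetric] by (simp add: mult_2)
    \<comment> \<open>The same chain, traversed from the last weight to the first.\<close>
    have "1 / D ^ N * G \<le> D ^ (N + 2) * F"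
    proof (rule ratio_lower_bound_of_chain[of G F _ _ "n k" "\<lambda>j. P k (n k + 1 - j)"])
      show "P k (n k + 1 - Suc j) * G \<le> D ^ (N + 2) * (P k (n k + 1 - j) * F)"
        if "1 \<le> j" "j < n k" for j
        using step(2)[of "n k - j"] that by (simp add: Suc_diff_le)
    qed (use ends D FG nk P_pos[OF k nk(2)] P_le_1[OF k nk(2)] D_ge_1 in auto)
    then have "G \<le> D ^ N * D ^ (N + 2) * F"
      using D(1) by (simp add: pos_divide_le_eq mult_ac)
    then have G_le: "G \<le> D ^ (2 * N + 2) * F"
      unfolding power_add[symmetric] by (simp add: mult_2)
    have DD: "D ^ (N + 2) * D ^ (2 * N + 2) = D ^ (3 * N + 4)"
      unfolding power_add[symmetric] by (rule arg_cong[where f = "power D"]) simp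
    have "P k (Suc i) * F \<le> D ^ (N + 2) * (P k i * (D ^ (2 * N + 2) * F))"
      using pos D_ge_1 by (intro order_trans[OF step(1)[OF i]] mult_left_mono G_le) auto
    moreover have "P k i * G \<le> D ^ (N + 2) * (P k (Suc i) * (D ^ (2 * N + 2) * G))"
      using pos D_ge_1 by (intro order_trans[OF step(2)[OF i]] mult_left_mono F_le) auto
    ultimately have "P k (Suc i) * F \<le> D ^ (3 * N + 4) * P k i * F"
      "P k i * G \<le> D ^ (3 * N + 4) * P k (Suc i) * G"
      unfolding DD[symmetric] by (simp_all add: mult_ac)
    then show ?thesis using FG by simp
  qed
  then show "P k i \<le> D ^ (3 * N + 4) * P k (Suc i)" and "P k (Suc i) \<le> D ^ (3 * N + 4) * P k i"
    by auto
qed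

text \<open>
  It suffices to look at one gap of level \<open>k\<close>, the first one in some cylinder. For the upper bound on
  \<open>F\<close>, the ball is centred at the left end of the cylinder of level \<open>k + t\<close> on the left bank. Since
  \<open>t \<ge> 1\<close>, this cylinder is the last child of its parent, so that its left neighbour is a sibling
  and (a) applies to it. The other bound is the mirror image.
\<close>

lemma cousins_comparable:
  assumes L: "k \<in> Lambda n c" and t: "1 \<le> t" "t < mm n c k"
  defines "F \<equiv> (\<Prod>j=1..t. P (k + j) 1)" and "G \<equiv> (\<Prod>j=1..t. P (k + j) (n (k + j)))"
  defines "A \<equiv> D ^ (3 * N + 4)"
  shows "F \<le> D\<^sup>2 * (1 + A) * A * G" and "G \<le> D\<^sup>2 * (1 + A) * A * F"
proof -
  have k1: "k \<ge> 1" using L by (auto simp: Lambda_def)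
  obtain k' where k: "k = Suc k'" using k1 by (cases k) auto
  obtain s where s: "t = Suc s" using t by (cases t) auto
  define K where "K = k + s"
  have "Suc K \<le> k + mm n c k - 1" using t s by (simp add: K_def)
  then have gap: "\<epsilon> k < \<delta> (Suc K)"
    using delta_antimono[OF data] mm_props(3)[OF data L] by (meson less_le_trans)
  have "[] \<in> W 0" by simp
  from append_lefts(1)[OF this, of k'] obtain w where w: "w \<in> W k'" by auto
  have i: "1 \<in> {1..n k}" "2 \<in> {1..n k}" using branching[OF k1] by auto
  define a where "a = w @ [1]"
  define b where "b = w @ [2]"
  have a: "a \<in> W k" and b: "b \<in> W k"
    using snoc_in_words[OF w] i k by (auto simp: a_def b_def)
  have ab: "lft b = rgt a + \<epsilon> k"
    using lft_snoc_Suc[OF w, of 1] i by (simp add: a_def b_def k numeral_2_eq_2)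
  have pos: "0 < mass w" "0 < P k 1" "0 < P k 2" "1 \<le> A" "0 < F" "0 < G"
    unfolding F_def G_def A_def k using mass_pos[OF w] P_pos[OF k1] i k D_ge_1 P_first_pos P_last_pos
    by (auto intro!: prod_pos)
  have sib: "P k 1 \<le> A * P k 2" "P k 2 \<le> A * P k 1"
    using siblings_comparable[OF k1, of 1] branching[OF k1] by (auto simp: A_def numeral_2_eq_2)
  define u where "u = a @ rights n k s"
  define v where "v = b @ lefts s"
  have u: "u \<in> W K" "rgt u = rgt a" and v: "v \<in> W K" "lft v = lft b"
    using append_rights[OF a, of s] append_lefts[OF b, of s] by (auto simp: u_def v_def K_def)
  let ?m = "n (Suc K)"
  have m: "?m \<in> {1..?m}" "?m - 1 \<in> {1..?m}" "1 \<in> {1..?m}" "2 \<in> {1..?m}" "2 \<le> ?m"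
    using branching[of "Suc K"] by auto
  note um = snoc_in_words[OF u(1) m(1)] and um' = snoc_in_words[OF u(1) m(2)]
    and v1 = snoc_in_words[OF v(1) m(3)] and v2 = snoc_in_words[OF v(1) m(4)]
  have mu: "mass (u @ [?m]) = mass w * (P k 1 * G)"
    using mass_append_rights[OF a, of t] mass_snoc[OF w]
    by (simp add: u_def a_def G_def s rights_Suc K_def k)
  have mv: "mass (v @ [1]) = mass w * (P k 2 * F)"
  proof -
    have "v @ [1] = b @ lefts t" unfolding v_def s lefts_Suc by simp
    then show ?thesis
      using mass_append_lefts[OF b, of t] mass_snoc[OF w, of 2] by (simp add: b_def F_def k)
  qed
  have mu': "mass (u @ [?m - 1]) \<le> A * mass (u @ [?m])"
    using siblings_comparable(1)[of "Suc K" "?m - 1"] m mass_pos[OF u(1)]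
    by (simp add: mass_snoc[OF u(1)] A_def mult_ac)
  have mv': "mass (v @ [2]) \<le> A * mass (v @ [1])"
    using siblings_comparable(2)[of "Suc K" 1] m mass_pos[OF v(1)]
    by (simp add: mass_snoc[OF v(1)] A_def mult_ac numeral_2_eq_2)
  have dp: "0 < \<delta> (Suc K)" "0 < \<epsilon> k" using \<delta>_pos \<epsilon>_pos[OF k1] by auto
  have ends: "rgt (u @ [?m]) = rgt a" "lft (v @ [1]) = lft b"
    using rgt_snoc_n[OF u(1)] lft_snoc_1[OF v(1)] u v by auto

  have "E \<inter> ball (lft (u @ [?m])) (\<delta> (Suc K)) \<subseteq> (\<Union>z\<in>{u @ [?m], u @ [?m - 1]}. I z)"
    using near_lft_last_child[OF _ u(1)] by (fastforce simp: dist_real_def abs_minus_commute)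
  moreover have "I (v @ [1]) \<subseteq> ball (lft (u @ [?m])) (2\<^sup>2 * \<delta> (Suc K))"
    using cyl_eq[OF v1] cyl_eq(2)[OF um] ends ab gap dp by (auto simp: dist_real_def)
  ultimately have "mass (v @ [1]) \<le> D\<^sup>2 * (\<Sum>z\<in>{u @ [?m], u @ [?m - 1]}. mass z)"
    using um um' dp by (intro mass_le_of_balls[OF lft_in_E[OF um] _ _ _ v1]) auto
  also have "\<dots> = D\<^sup>2 * (mass (u @ [?m]) + mass (u @ [?m - 1]))"
    using m(5) by simp
  also have "\<dots> \<le> D\<^sup>2 * ((1 + A) * mass (u @ [?m]))"
    using mu' by (intro mult_left_mono) (auto simp: algebra_simps)
  finally have vu: "P k 2 * F \<le> D\<^sup>2 * (1 + A) * (P k 1 * G)"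
    using pos(1) unfolding mu mv by (simp add: mult_ac)
  have "P k 2 * F \<le> D\<^sup>2 * (1 + A) * (A * P k 2 * G)"
    using vu sib(1) pos by (elim order_trans) (intro mult_left_mono mult_right_mono, auto)
  then show "F \<le> D\<^sup>2 * (1 + A) * A * G"
    using pos(3) by (simp add: mult_ac)

  have "E \<inter> ball (rgt (v @ [1])) (\<delta> (Suc K)) \<subseteq> (\<Union>z\<in>{v @ [1], v @ [2]}. I z)"
    using near_rgt_first_child[OF _ v(1)] by (fastforce simp: dist_real_def abs_minus_commute)
  moreover have "I (u @ [?m]) \<subseteq> ball (rgt (v @ [1])) (2\<^sup>2 * \<delta> (Suc K))"
    using cyl_eq[OF um] cyl_eq(2)[OF v1] ends ab gap dp by (auto simp: dist_real_def)
  ultimately have "mass (u @ [?m]) \<le> D\<^sup>2 * (\<Sum>z\<in>{v @ [1], v @ [2]}. mass z)"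
    using v1 v2 dp by (intro mass_le_of_balls[OF rgt_in_E[OF v1] _ _ _ um]) auto
  also have "\<dots> = D\<^sup>2 * (mass (v @ [1]) + mass (v @ [2]))" by simp
  also have "\<dots> \<le> D\<^sup>2 * ((1 + A) * mass (v @ [1]))"
    using mv' by (intro mult_left_mono) (auto simp: algebra_simps)
  finally have uv: "P k 1 * G \<le> D\<^sup>2 * (1 + A) * (P k 2 * F)"
    using pos(1) unfolding mu mv by (simp add: mult_ac)
  have "P k 1 * G \<le> D\<^sup>2 * (1 + A) * (A * P k 1 * F)"
    using uv sib(2) pos by (elim order_trans) (intro mult_left_mono mult_right_mono, auto)
  then show "G \<le> D\<^sup>2 * (1 + A) * A * F"
    using pos(2) by (simp add: mult_ac)
qed

end

theorem corollary1:
  fixes n :: "nat \<Rightarrow> nat" and c :: "nat \<Rightarrow> real" and P :: "nat \<Rightarrow> nat \<Rightarrow> real"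
    and \<mu> :: "real measure"
  assumes "uniform_cantor_data n c"
    and "n_matching n P"
    and "is_cantor_measure n c P \<mu>"
    and "bdd_above (n ` {1..})"
  shows "doubling_measure_on (cantor_set n c) \<mu> \<longleftrightarrow>
    (\<exists>C>1.
      (\<forall>k\<ge>1. \<forall>i. 1 \<le> i \<and> i < n k \<longrightarrow>
         inverse C * P k i \<le> P k (i + 1) \<and> P k (i + 1) \<le> C * P k i) \<and>
      (\<forall>k\<in>Lambda n c. \<forall>t. 1 \<le> t \<and> t < mm n c k \<longrightarrow>
         inverse C * (\<Prod>j=1..t. P (k + j) 1) \<le> (\<Prod>j=1..t. P (k + j) (n (k + j))) \<and>
         (\<Prod>j=1..t. P (k + j) (n (k + j))) \<le> C * (\<Prod>j=1..t. P (k + j) 1)))"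
proof -
  interpret cantor_mass n c P \<mu>
    using assms by unfold_locales
  obtain N where N: "\<And>k. k \<ge> 1 \<Longrightarrow> n k \<le> N"
    using assms(4) by (auto simp: bdd_above_def)
  have inv: "inverse C * x \<le> y \<longleftrightarrow> x \<le> C * y" if "C > 1" for C x y :: real
    using that by (simp add: field_simps)
  show ?thesis
  proof
    assume "doubling_measure_on (cantor_set n c) \<mu>"
    then obtain D where "doubling_constant D" using doubling_iff by blast
    then interpret doubling_cantor_mass n c P \<mu> D N
      using N by unfold_locales
    define A where "A = D ^ (3 * N + 4)"
    define C where "C = 1 + D\<^sup>2 * (1 + A) * A"
    have A: "1 \<le> A" and D2: "1 \<le> D\<^sup>2" using D_ge_1 by (auto simp: A_def)
    have "1 \<le> D\<^sup>2 * (1 + A)" using mult_mono[of 1 "D\<^sup>2" 1 "1 + A"] A D2 by simp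
    then have "A \<le> D\<^sup>2 * (1 + A) * A" using A by simp
    then have C: "1 < C" "A \<le> C" "D\<^sup>2 * (1 + A) * A \<le> C"
      using A unfolding C_def by linarith+
    have "P k i \<le> C * P k (i + 1) \<and> P k (i + 1) \<le> C * P k i"
      if "k \<ge> 1" "1 \<le> i \<and> i < n k" for k i
    proof -
      have "A * P k i \<le> C * P k i" "A * P k (Suc i) \<le> C * P k (Suc i)"
        using C P_pos[of k] that by (auto intro!: mult_right_mono less_imp_le)
      then show ?thesis
        using siblings_comparable[of k i] that unfolding A_def[symmetric] by auto
    qed
    moreover have "(\<Prod>j=1..t. P (k + j) 1) \<le> C * (\<Prod>j=1..t. P (k + j) (n (k + j))) \<and>
        (\<Prod>j=1..t. P (k + j) (n (k + j))) \<le> C * (\<Prod>j=1..t. P (k + j) 1)"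
      if "k \<in> Lambda n c" "1 \<le> t \<and> t < mm n c k" for k t
    proof -
      let ?F = "\<Prod>j=1..t. P (k + j) 1" and ?G = "\<Prod>j=1..t. P (k + j) (n (k + j))"
      have "k \<noteq> 0" using that(1) by (auto simp: Lambda_def)
      then obtain k' where k': "k = Suc k'" using not0_implies_Suc by blast
      have F: "0 \<le> ?F" and G: "0 \<le> ?G"
        unfolding k' using P_first_pos P_last_pos by (auto intro!: less_imp_le prod_pos)
      show ?thesis
        using cousins_comparable[OF that(1)] that(2) mult_right_mono[OF C(3) F]
          mult_right_mono[OF C(3) G]
        unfolding A_def[symmetric] by (blast intro: order_trans)
    qed
    ultimately show "\<exists>C>1.
      (\<forall>k\<ge>1. \<forall>i. 1 \<le> i \<and> i < n k \<longrightarrow>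
         inverse C * P k i \<le> P k (i + 1) \<and> P k (i + 1) \<le> C * P k i) \<and>
      (\<forall>k\<in>Lambda n c. \<forall>t. 1 \<le> t \<and> t < mm n c k \<longrightarrow>
         inverse C * (\<Prod>j=1..t. P (k + j) 1) \<le> (\<Prod>j=1..t. P (k + j) (n (k + j))) \<and>
         (\<Prod>j=1..t. P (k + j) (n (k + j))) \<le> C * (\<Prod>j=1..t. P (k + j) 1))"
      using C(1) inv[OF C(1)] by (intro exI[of _ C]) simp
  next
    assume "\<exists>C>1.
      (\<forall>k\<ge>1. \<forall>i. 1 \<le> i \<and> i < n k \<longrightarrow>
         inverse C * P k i \<le> P k (i + 1) \<and> P k (i + 1) \<le> C * P k i) \<and>
      (\<forall>k\<in>Lambda n c. \<forall>t. 1 \<le> t \<and> t < mm n c k \<longrightarrow>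
         inverse C * (\<Prod>j=1..t. P (k + j) 1) \<le> (\<Prod>j=1..t. P (k + j) (n (k + j))) \<and>
         (\<Prod>j=1..t. P (k + j) (n (k + j))) \<le> C * (\<Prod>j=1..t. P (k + j) 1))"
    then obtain C where C: "1 < C"
      and ab: "\<forall>k\<ge>1. \<forall>i. 1 \<le> i \<and> i < n k \<longrightarrow> P k i \<le> C * P k (i + 1) \<and> P k (i + 1) \<le> C * P k i"
        "\<forall>k\<in>Lambda n c. \<forall>t. 1 \<le> t \<and> t < mm n c k \<longrightarrow>
          (\<Prod>j=1..t. P (k + j) 1) \<le> C * (\<Prod>j=1..t. P (k + j) (n (k + j))) \<and>
          (\<Prod>j=1..t. P (k + j) (n (k + j))) \<le> C * (\<Prod>j=1..t. P (k + j) 1)"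
      using inv by auto
    have "\<exists>D. doubling_constant D"
      using ab by (intro sufficiency[OF C N]) auto
    then show "doubling_measure_on (cantor_set n c) \<mu>" using doubling_iff by blast
  qed
qed

end
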